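(* Assume that $K$ is injective; that there exists an injective operator $A\in\mathcal{L}(\mathcal{Y})$ with $\lim_{m\to\infty}P_m^*P_my=Ay$ for all $y\in\mathcal{Y}$; that for all $m,j\in\mathbb{N}$ the random variables $(\delta_{ij}^{(m)})_{i\in\mathbb{N}}$ are independent with zero mean and there exists $C_d\in\mathbb{R}$ with $$\sup_{\substack{m,i,j\in\mathbb{N}\\ j\le m}}\mathbb{E}\big[(\delta^{(m)}_{ij})^2\big]\le C_d ;$$ and that $(F_\alpha)_{\alpha>0}$ satisfies the filter conditions given in the context. Take an a priori parameter choice rule with $\alpha(\delta)\to0$ and $\delta/\sqrt{\alpha(\delta)}\to0$ as $\delta\to0$, and put $\delta^{est}_{m,n}=\sqrt{m/n}$. Then there holds $$\lim_{\substack{m,n\to\infty\\ m/n\to0}}\mathbb{E}\left\|R^{(m)}_{\alpha(\delta_{m,n}^{est})}\bar Y_n^{(m)}-K^+\hat y\right\|^2=0 .$$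
   Context: $\mathcal{X},\mathcal{Y}$ are real Hilbert spaces, $K:\mathcal{X}\to\mathcal{Y}$ is a compact linear operator, $K^+$ is its generalised (Moore-Penrose) inverse with domain $\mathcal{D}(K^+)$, and $\hat y\in\mathcal{D}(K^+)$ is the exact right-hand side of the equation $K\hat x=\hat y$ to be solved. Discretisation: for each $m\in\mathbb{N}$, $l^{(m)}_1,\dots,l_m^{(m)}$ are continuous linear functionals on $\mathcal{Y}$ with $\|l_1^{(m)}\|=\dots=\|l_m^{(m)}\|$, and $P_m:\mathcal{Y}\to\mathbb{R}^m$, $P_my=(l_1^{(m)}(y),\dots,l_m^{(m)}(y))^T$; it is assumed that $P_mP_m^*$ is bijective. Measurements: $Y^{(m)}_{ij}=l_j^{(m)}(\hat y)+\delta_{ij}^{(m)}$ and $\bar Y_n^{(m)}=\frac1n\sum_{i=1}^n(Y^{(m)}_{i1},\dots,Y^{(m)}_{im})^T$. Filter conditions: $(F_\alpha)_{\alpha>0}$ are piecewise continuous real-valued functions on $[0,\|K\|^2]$ such that: (i) $\lim_{\alpha\to0}\sup_{\varepsilon\le\lambda\le\|K\|^2}|F_\alpha(\lambda)-1/\lambda|=0$ for all $\varepsilon>0$; (ii) there is $C_R\in\mathbb{R}$ with $\lambda|F_\alpha(\lambda)|\le C_R$ for all $\lambda\in(0,\|K\|^2]$ and $\alpha>0$; (iii) it has qualification $\nu_0\ge0$, i.e. $\nu_0$ is maximal such that for all $0\le\nu\le\nu_0$ there exists a constant $C_\nu\in\mathbb{R}$ with $\sup_{\lambda\in(0,\|K\|^2]}\lambda^{\nu/2}|1-F_\alpha(\lambda)\lambda|\le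 C_\nu\alpha^{\nu/2}$, where for $\nu=0$ the constant $C_0$ is assumed to be known; (iv) there is $C_F\in\mathbb{R}$ with $|F_\alpha(\lambda)|\le C_F/\alpha$ for all $\alpha>0$ and $\lambda\in(0,\|K\|^2]$. Regularisation: $R^{(m)}_\alpha:=F_\alpha\big((P_mK)^*P_mK\big)(P_mK)^*$.
   Formalization: The exact data are assumed attainable, K x̂ = ŷ (for ŷ only in D(K⁺) the claim can fail), and the filters are taken on an interval [0,κ], κ ≥ ‖K‖², that contains the spectra of all (P_mK)*P_mK, so that F_α((P_mK)*P_mK) is defined. *)

theory Defs
  imports "HOL-Probability.Probability"
begin

section \<open>Operators between Hilbert spaces\<close>

definition compact_operator :: "('a::real_normed_vector \<Rightarrow> 'b::real_normed_vector) \<Rightarrow> bool" where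
  "compact_operator K \<longleftrightarrow> linear K \<and> (\<forall>B. bounded B \<longrightarrow> compact (closure (K ` B)))"

definition mp_domain :: "('a::real_inner \<Rightarrow> 'b::real_inner) \<Rightarrow> 'b set" where
  "mp_domain K = {u + v | u v. u \<in> range K \<and> v \<in> orthogonal_comp (range K)}"

text \<open>For \<open>y = u + v\<close> with \<open>u\<close> in the range of \<open>K\<close> and \<open>v\<close> orthogonal to it, \<open>mp_inverse K y\<close>
  is the preimage of \<open>u\<close> under the restriction of \<open>K\<close> to the orthogonal complement of its kernel.
  It is meaningful only on \<open>mp_domain K\<close>.\<close>

definition mp_inverse :: "('a::real_inner \<Rightarrow> 'b::real_inner) \<Rightarrow> 'b \<Rightarrow> 'a" where
  "mp_inverse K y =
     (THE x. x \<in> orthogonal_comp {z. K z = 0} \<and> y - K x \<in> orthogonal_comp (range K))"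

definition orth_proj :: "'a::real_inner set \<Rightarrow> 'a \<Rightarrow> 'a" where
  "orth_proj S x = (THE p. p \<in> S \<and> x - p \<in> orthogonal_comp S)"

definition eigenspace :: "('a::real_vector \<Rightarrow> 'a) \<Rightarrow> real \<Rightarrow> 'a set" where
  "eigenspace T t = {v. T v = t *\<^sub>R v}"

definition eigenvalues :: "('a::real_vector \<Rightarrow> 'a) \<Rightarrow> real set" where
  "eigenvalues T = {t. \<exists>v. v \<noteq> 0 \<and> T v = t *\<^sub>R v}"

text \<open>The functional calculus \<open>f(T)\<close> of a compact self-adjoint \<open>T\<close>, through the spectral
  decomposition of \<open>T\<close>. The eigenvalue \<open>0\<close> is included, so that \<open>f(T)\<close> acts as \<open>f 0\<close> on the
  kernel of \<open>T\<close>. Below, \<open>T\<close> has finite rank and the sum is finite.\<close>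

definition fun_calculus :: "(real \<Rightarrow> real) \<Rightarrow> ('a::real_inner \<Rightarrow> 'a) \<Rightarrow> 'a \<Rightarrow> 'a" where
  "fun_calculus f T x = (\<Sum>\<^sub>\<infinity>t\<in>eigenvalues T. f t *\<^sub>R orth_proj (eigenspace T t) x)"


section \<open>Discretisation\<close>

text \<open>Since \<open>m\<close> varies, \<open>\<real>\<^sup>m\<close> is the set of functions on the index set \<open>{1..m}\<close>
  (extended by \<^const>\<open>undefined\<close>), carrying the Euclidean inner product
  \<open>\<Sum>j=1..m. v j * w j\<close>.\<close>

definition Rvec :: "nat \<Rightarrow> (nat \<Rightarrow> real) set" where
  "Rvec m = {1..m} \<rightarrow>\<^sub>E UNIV"

text \<open>The Hilbert space adjoint of an operator \<open>L\<close> into \<open>\<real>\<^sup>m\<close>; it exists when \<open>L\<close> is linear and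
  bounded, by the Riesz representation theorem.\<close>

definition adj_Rvec :: "nat \<Rightarrow> ('a::real_inner \<Rightarrow> nat \<Rightarrow> real) \<Rightarrow> (nat \<Rightarrow> real) \<Rightarrow> 'a" where
  "adj_Rvec m L v = (THE z. \<forall>x. inner z x = (\<Sum>j=1..m. v j * L x j))"

definition discr :: "(nat \<Rightarrow> nat \<Rightarrow> 'b \<Rightarrow> real) \<Rightarrow> nat \<Rightarrow> 'b \<Rightarrow> nat \<Rightarrow> real" where
  "discr l m y = (\<lambda>j\<in>{1..m}. l m j y)"

text \<open>The operator \<open>(P\<^sub>m K)\<^sup>* P\<^sub>m K\<close>.\<close>

definition gram ::
    "(nat \<Rightarrow> nat \<Rightarrow> 'b \<Rightarrow> real) \<Rightarrow> ('a::real_inner \<Rightarrow> 'b) \<Rightarrow> nat \<Rightarrow> 'a \<Rightarrow> 'a" where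
  "gram l K m x = adj_Rvec m (discr l m \<circ> K) (discr l m (K x))"

definition regularisation ::
    "(real \<Rightarrow> real \<Rightarrow> real) \<Rightarrow> (nat \<Rightarrow> nat \<Rightarrow> 'b \<Rightarrow> real) \<Rightarrow> ('a::real_inner \<Rightarrow> 'b)
      \<Rightarrow> nat \<Rightarrow> real \<Rightarrow> (nat \<Rightarrow> real) \<Rightarrow> 'a" where
  "regularisation F l K m \<alpha> v =
     fun_calculus (F \<alpha>) (gram l K m) (adj_Rvec m (discr l m \<circ> K) v)"

definition measurement ::
    "(nat \<Rightarrow> nat \<Rightarrow> 'b \<Rightarrow> real) \<Rightarrow> 'b \<Rightarrow> (nat \<Rightarrow> nat \<Rightarrow> nat \<Rightarrow> 'w \<Rightarrow> real)
      \<Rightarrow> nat \<Rightarrow> nat \<Rightarrow> nat \<Rightarrow> 'w \<Rightarrow> real" where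
  "measurement l y \<delta> m i j \<omega> = l m j y + \<delta> m i j \<omega>"

definition mean_measurement ::
    "(nat \<Rightarrow> nat \<Rightarrow> 'b \<Rightarrow> real) \<Rightarrow> 'b \<Rightarrow> (nat \<Rightarrow> nat \<Rightarrow> nat \<Rightarrow> 'w \<Rightarrow> real)
      \<Rightarrow> nat \<Rightarrow> nat \<Rightarrow> 'w \<Rightarrow> nat \<Rightarrow> real" where
  "mean_measurement l y \<delta> m n \<omega> =
     (\<lambda>j\<in>{1..m}. (1 / real n) * (\<Sum>i=1..n. measurement l y \<delta> m i j \<omega>))"


section \<open>Filters\<close>

definition piecewise_continuous_on :: "real \<Rightarrow> real \<Rightarrow> (real \<Rightarrow> real) \<Rightarrow> bool" where
  "piecewise_continuous_on a b f \<longleftrightarrow>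
     (\<exists>S. finite S \<and> continuous_on ({a..b} - S) f) \<and>
     (\<forall>x\<in>{a..<b}. \<exists>c. (f \<longlongrightarrow> c) (at_right x)) \<and>
     (\<forall>x\<in>{a<..b}. \<exists>c. (f \<longlongrightarrow> c) (at_left x))"

text \<open>\<open>\<nu>0\<close> is extended real, as a filter (e.g. the truncated singular value decomposition) may
  satisfy the estimate for every \<open>\<nu>\<close>. Then its qualification is \<open>\<infinity>\<close>.\<close>

definition qualification_bound :: "real \<Rightarrow> (real \<Rightarrow> real \<Rightarrow> real) \<Rightarrow> ereal \<Rightarrow> bool" where
  "qualification_bound \<kappa> F \<nu>0 \<longleftrightarrow>
     (\<forall>\<nu>::real. 0 \<le> \<nu> \<and> ereal \<nu> \<le> \<nu>0 \<longrightarrow>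
        (\<exists>C::real. \<forall>\<alpha>>0. \<forall>t\<in>{0<..\<kappa>}.
           t powr (\<nu> / 2) * \<bar>1 - F \<alpha> t * t\<bar> \<le> C * \<alpha> powr (\<nu> / 2)))"

definition has_qualification :: "real \<Rightarrow> (real \<Rightarrow> real \<Rightarrow> real) \<Rightarrow> ereal \<Rightarrow> bool" where
  "has_qualification \<kappa> F \<nu>0 \<longleftrightarrow>
     0 \<le> \<nu>0 \<and> qualification_bound \<kappa> F \<nu>0 \<and> (\<forall>\<nu>1. qualification_bound \<kappa> F \<nu>1 \<longrightarrow> \<nu>1 \<le> \<nu>0)"

text \<open>A family \<open>(F\<^sub>\<alpha>)\<close>, \<open>\<alpha> > 0\<close>, of filter functions on \<open>[0, \<kappa>]\<close>; the values of \<open>F \<alpha>\<close> outside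
  this interval are irrelevant.\<close>

definition regularising_filter :: "real \<Rightarrow> (real \<Rightarrow> real \<Rightarrow> real) \<Rightarrow> ereal \<Rightarrow> bool" where
  "regularising_filter \<kappa> F \<nu>0 \<longleftrightarrow>
     (\<forall>\<alpha>>0. piecewise_continuous_on 0 \<kappa> (F \<alpha>)) \<and>
     (\<forall>\<epsilon>>0. uniform_limit {\<epsilon>..\<kappa>} F (\<lambda>t. 1 / t) (at_right 0)) \<and>
     (\<exists>C\<^sub>R::real. \<forall>\<alpha>>0. \<forall>t\<in>{0<..\<kappa>}. t * \<bar>F \<alpha> t\<bar> \<le> C\<^sub>R) \<and>
     has_qualification \<kappa> F \<nu>0 \<and>
     (\<exists>C\<^sub>F::real. \<forall>\<alpha>>0. \<forall>t\<in>{0<..\<kappa>}. \<bar>F \<alpha> t\<bar> \<le> C\<^sub>F / \<alpha>)"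


section \<open>The joint limit\<close>

text \<open>The filter of pairs \<open>(m, n)\<close> with \<open>m, n \<rightarrow> \<infinity>\<close> and \<open>m / n \<rightarrow> 0\<close>: a property holds eventually
  iff there are \<open>N\<close> and \<open>\<eta> > 0\<close> such that it holds whenever \<open>m, n \<ge> N\<close> and \<open>m / n < \<eta>\<close>.\<close>

definition joint_limit :: "(nat \<times> nat) filter" where
  "joint_limit =
     inf (sequentially \<times>\<^sub>F sequentially) (filtercomap (\<lambda>(m, n). real m / real n) (nhds 0))"

end

theory Submission
  imports Defs
begin

text \<open>
  The error splits into the bias \<open>F\<^sub>\<alpha>(T\<^sub>m) T\<^sub>m x - x\<close>, where \<open>T\<^sub>m = (P\<^sub>m K)\<^sup>* P\<^sub>m K\<close>
  and \<open>x = K\<^sup>+ y\<close>, and the propagated noise. By conditions (ii) and (iv), \<open>t F\<^sub>\<alpha>(t)\<^sup>2 \<le> C / \<alpha>\<close>, hence the mean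
  square of the noise term is at most \<open>C / \<alpha>\<close> times that of the averaged measurement
  errors, which is \<open>O(m / n)\<close>. This tends to \<open>0\<close> by the choice of \<open>\<alpha>\<close>.
  For the bias, \<open>T\<^sub>m\<close> converges strongly to \<open>G = K\<^sup>* A K\<close>, which is self-adjoint and injective
  because \<open>A\<close> is positive semidefinite, so its range is dense. Choose \<open>w\<close> with \<open>G w\<close> close to
  \<open>x\<close>. Then \<open>x - T\<^sub>m w\<close> is eventually small and the residuals \<open>1 - t F\<^sub>\<alpha>(t)\<close> are bounded, while on
  \<open>T\<^sub>m w\<close> the residual is controlled by \<open>sup\<^sub>t t |1 - t F\<^sub>\<alpha>(t)|\<close>, which tends to \<open>0\<close> as \<open>\<alpha> \<rightarrow> 0\<close>.
\<close>

section \<open>Hilbert spaces\<close>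

text \<open>A minimising sequence for the distance to \<open>x\<close> is Cauchy: midpoints stay in
  \<open>V\<close>, so the parallelogram law bounds the gap between two members by their excess over
  the infimum. Completeness supplies the limit.\<close>

lemma hilbert_projection_exists:
  fixes V :: "'a::{real_inner, complete_space} set"
  assumes V: "subspace V" "closed V"
  obtains p where "p \<in> V" "\<And>v. v \<in> V \<Longrightarrow> inner (x - p) v = 0"
proof -
  define d where "d = (INF v\<in>V. (norm (x - v))\<^sup>2)"
  have bdd: "bdd_below ((\<lambda>v. (norm (x - v))\<^sup>2) ` V)"
    by (auto intro!: bdd_belowI[of _ 0])
  have ne: "V \<noteq> {}"
    using V(1) subspace_0 by blast
  have d_le: "d \<le> (norm (x - v))\<^sup>2" if "v \<in> V" for v
    unfolding d_def by (rule cINF_lower[OF bdd that])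
  have "\<exists>v\<in>V. (norm (x - v))\<^sup>2 < d + inverse (real (Suc n))" for n
    using cINF_less_iff[OF ne bdd, of "d + inverse (real (Suc n))"] by (simp add: d_def)
  then obtain v where v: "\<And>n. v n \<in> V" "\<And>n. (norm (x - v n))\<^sup>2 < d + inverse (real (Suc n))"
    by metis
  have diff: "(norm (v n - v k))\<^sup>2 \<le> 2 * inverse (real (Suc n)) + 2 * inverse (real (Suc k))" for n k
  proof -
    have "(1/2) *\<^sub>R (v n + v k) \<in> V"
      using V(1) v(1) by (simp add: subspace_add subspace_scale)
    then have "d \<le> (norm (x - (1/2) *\<^sub>R (v n + v k)))\<^sup>2"
      by (rule d_le)
    moreover have "(norm (v n - v k))\<^sup>2 + 4 * (norm (x - (1/2) *\<^sub>R (v n + v k)))\<^sup>2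
        = 2 * (norm (x - v n))\<^sup>2 + 2 * (norm (x - v k))\<^sup>2"
      unfolding power2_norm_eq_inner
      by (simp add: inner_simps inner_commute algebra_simps)
    ultimately show ?thesis
      using v(2)[of n] v(2)[of k] by linarith
  qed
  have "Cauchy v"
  proof (rule metric_CauchyI)
    fix e :: real assume "0 < e"
    then obtain N where N: "inverse (real (Suc N)) < e\<^sup>2 / 4"
      using reals_Archimedean[of "e\<^sup>2 / 4"] by auto
    have "dist (v n) (v k) < e" if "n \<ge> N" "k \<ge> N" for n k
    proof -
      have "inverse (real (Suc n)) \<le> inverse (real (Suc N))"
        "inverse (real (Suc k)) \<le> inverse (real (Suc N))"
        using that by (auto intro!: le_imp_inverse_le)
      then have "(norm (v n - v k))\<^sup>2 < e\<^sup>2"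
        using diff[of n k] N by linarith
      then show ?thesis
        using \<open>0 < e\<close> by (simp add: dist_norm power2_less_imp_less)
    qed
    then show "\<exists>N. \<forall>n\<ge>N. \<forall>k\<ge>N. dist (v n) (v k) < e"
      by blast
  qed
  then obtain p where p: "v \<longlonglongrightarrow> p"
    using Cauchy_convergent convergent_def by blast
  have "p \<in> V"
    using closed_sequentially[OF V(2)] v(1) p by blast
  have "(\<lambda>n. (norm (x - v n))\<^sup>2) \<longlonglongrightarrow> (norm (x - p))\<^sup>2"
    by (intro tendsto_intros p)
  moreover have "(\<lambda>n. d + inverse (real (Suc n))) \<longlonglongrightarrow> d + 0"
    by (intro tendsto_add tendsto_const LIMSEQ_inverse_real_of_nat)
  ultimately have "(norm (x - p))\<^sup>2 \<le> d"
    using LIMSEQ_le[of "\<lambda>n. (norm (x - v n))\<^sup>2" _ "\<lambda>n. d + inverse (real (Suc n))" "d + 0"] v(2)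
    by (metis (mono_tags, lifting) add_0_right less_imp_le)
  then have closest: "\<forall>z\<in>V. dist x p \<le> dist x z"
    using d_le by (metis dist_norm norm_ge_zero order_trans power2_le_imp_le)
  \<comment> \<open>The variational inequality at the closest point, tested with
    \<open>p + v\<close>. Using both \<open>v\<close> and \<open>- v\<close> turns it into
    orthogonality.\<close>
  have le0: "inner (x - p) v \<le> 0" if "v \<in> V" for v
    using any_closest_point_dot[OF subspace_imp_convex[OF V(1)] V(2) \<open>p \<in> V\<close> _ closest, of "p + v"]
      subspace_add[OF V(1) \<open>p \<in> V\<close> that] by simp
  have "inner (x - p) v = 0" if "v \<in> V" for v
    using le0[OF that] le0[OF subspace_neg[OF V(1) that]] by simp
  then show thesis
    using that \<open>p \<in> V\<close> by blast
qed

lemma subspace_closure: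
  fixes V :: "'a::real_normed_vector set"
  assumes "subspace V"
  shows "subspace (closure V)"
  unfolding subspace_def
proof (intro conjI ballI allI)
  show "0 \<in> closure V"
    using subspace_0[OF assms] closure_subset by blast
next
  fix x y assume "x \<in> closure V" "y \<in> closure V"
  then obtain f g where "\<And>n. f n \<in> V" "f \<longlonglongrightarrow> x" "\<And>n. g n \<in> V" "g \<longlonglongrightarrow> y"
    unfolding closure_sequential by blast
  then show "x + y \<in> closure V"
    unfolding closure_sequential
    by (intro exI[of _ "\<lambda>n. f n + g n"] conjI allI tendsto_add subspace_add[OF assms])
next
  fix c :: real and x assume "x \<in> closure V"
  then obtain f where "\<And>n. f n \<in> V" "f \<longlonglongrightarrow> x"
    unfolding closure_sequential by blast
  then show "c *\<^sub>R x \<in> closure V"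
    unfolding closure_sequential
    by (intro exI[of _ "\<lambda>n. c *\<^sub>R f n"] conjI allI tendsto_scaleR tendsto_const subspace_scale[OF assms])
qed

text \<open>The component of a vector orthogonal to the closed range lies in the kernel of the
  adjoint, which is \<open>G\<close> itself; injectivity makes it 0.\<close>

lemma dense_range_if_injective_self_adjoint:
  fixes G :: "'a::{real_inner, complete_space} \<Rightarrow> 'a"
  assumes "linear G" and sa: "\<And>x y. inner (G x) y = inner x (G y)"
    and inj: "\<And>x. G x = 0 \<Longrightarrow> x = 0"
  shows "closure (range G) = UNIV"
proof (rule ccontr)
  have sub: "subspace (closure (range G))"
    using linear_subspace_image[OF assms(1) subspace_UNIV] by (rule subspace_closure)
  assume "closure (range G) \<noteq> UNIV"
  then obtain x where x: "x \<notin> closure (range G)"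
    by auto
  obtain p where p: "p \<in> closure (range G)" "\<And>v. v \<in> closure (range G) \<Longrightarrow> inner (x - p) v = 0"
    using hilbert_projection_exists[OF sub closed_closure, of x] by blast
  have "inner (G (x - p)) y = 0" for y
  proof -
    have "inner (x - p) (G y) = 0"
      by (rule p(2)) (rule subsetD[OF closure_subset rangeI])
    then show ?thesis
      by (simp only: sa)
  qed
  then have "G (x - p) = 0"
    by (metis inner_eq_zero_iff)
  then have "x = p"
    using inj[of "x - p"] by simp
  then show False
    using x p(1) by simp
qed

text \<open>The kernel has codimension at most one, so any nonzero vector orthogonal to it
  represents the functional up to a scalar.\<close>

lemma riesz_representation:
  fixes \<phi> :: "'a::{real_inner, complete_space} \<Rightarrow> real"
  assumes "bounded_linear \<phi>"
  obtains z where "\<And>x. \<phi> x = inner z x"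
proof (cases "\<forall>x. \<phi> x = 0")
  case True
  then show thesis
    using that[of 0] by simp
next
  case False
  then obtain a where a: "\<phi> a \<noteq> 0"
    by blast
  interpret \<phi>: bounded_linear \<phi> by fact
  let ?N = "{x. \<phi> x = 0}"
  have "subspace ?N"
    by (auto simp: subspace_def \<phi>.add \<phi>.scaleR \<phi>.zero)
  moreover have "closed ?N"
    using closed_Collect_eq[of \<phi> "\<lambda>_. 0"] \<phi>.continuous_on[OF continuous_on_id] by simp
  ultimately obtain p where p: "\<phi> p = 0" "\<And>v. \<phi> v = 0 \<Longrightarrow> inner (a - p) v = 0"
    using hilbert_projection_exists[of ?N a] by auto
  define u where "u = a - p"
  have u: "\<phi> u = \<phi> a"
    by (simp add: u_def \<phi>.diff p(1))
  then have "u \<noteq> 0"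
    using a \<phi>.zero by auto
  \<comment> \<open>The vector \<open>x - (\<phi> x / \<phi> a) *\<^sub>R u\<close> lies in the
    kernel and is therefore orthogonal to \<open>u\<close>; solving for \<open>\<phi> x\<close>
    gives the scalar.\<close>
  have "\<phi> x = inner ((\<phi> a / inner u u) *\<^sub>R u) x" for x
  proof -
    have "\<phi> (x - (\<phi> x / \<phi> a) *\<^sub>R u) = 0"
      using a by (simp add: \<phi>.diff \<phi>.scaleR u)
    then have "inner u (x - (\<phi> x / \<phi> a) *\<^sub>R u) = 0"
      using p(2) by (simp add: u_def)
    then show ?thesis
      using a \<open>u \<noteq> 0\<close> by (simp add: inner_simps field_simps)
  qed
  then show thesis
    using that by blast
qed

text \<open>Riesz is applied for each \<open>y\<close> separately; linearity follows because a
  vector is determined by its inner products. For the bound, the square of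
  \<open>norm (K' y)\<close> is \<open>inner y (K (K' y))\<close>, and one factor cancels.\<close>

lemma hilbert_adjoint_exists:
  fixes K :: "'a::{real_inner, complete_space} \<Rightarrow> 'b::real_inner"
  assumes "bounded_linear K"
  obtains K' where "bounded_linear K'" "\<And>y x. inner (K' y) x = inner y (K x)"
proof -
  have "\<exists>z. \<forall>x. inner y (K x) = inner z x" for y
    using riesz_representation[OF bounded_linear_compose[OF bounded_linear_inner_right assms]]
    by metis
  then obtain K' where K': "\<And>y x. inner (K' y) x = inner y (K x)"
    by metis
  have "bounded_linear K'"
  proof (rule bounded_linear_intro[where K = "onorm K"])
    show "K' (y + y') = K' y + K' y'" for y y'
      by (rule vector_eq_rdot[THEN iffD1]) (simp add: K' inner_add_left)
    show "K' (c *\<^sub>R y) = c *\<^sub>R K' y" for c y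
      by (rule vector_eq_rdot[THEN iffD1]) (simp add: K')
    show "norm (K' y) \<le> norm y * onorm K" for y
    proof (cases "K' y = 0")
      case True
      then show ?thesis
        by (simp add: onorm_pos_le[OF assms])
    next
      case False
      have "norm (K' y) * norm (K' y) = inner y (K (K' y))"
        by (simp add: dot_square_norm power2_eq_square flip: K')
      also have "\<dots> \<le> norm y * norm (K (K' y))"
        by (rule norm_cauchy_schwarz)
      also have "\<dots> \<le> norm y * (onorm K * norm (K' y))"
        by (intro mult_left_mono onorm[OF assms] norm_ge_zero)
      finally have "norm (K' y) * norm (K' y) \<le> (norm y * onorm K) * norm (K' y)"
        by (simp add: mult.assoc)
      then show ?thesis
        by (rule mult_right_le_imp_le) (use False in simp)
    qed
  qed
  then show thesis
    using that K' by blast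
qed

section \<open>Frame operators and their spectral decomposition\<close>

text \<open>Bolzano-Weierstrass for one coefficient at a time, each time refining the subsequence
  already found.\<close>

lemma bounded_family_convergent_subsequence:
  fixes c :: "'i \<Rightarrow> nat \<Rightarrow> real"
  assumes "finite J" "\<And>j. j \<in> J \<Longrightarrow> bounded (range (c j))"
  obtains r where "strict_mono r" "\<And>j. j \<in> J \<Longrightarrow> convergent (c j \<circ> r)"
  using assms
proof (induction J arbitrary: thesis rule: finite_induct)
  case empty
  then show ?case
    using strict_mono_id by blast
next
  case (insert i J)
  obtain r where r: "strict_mono r" "\<And>j. j \<in> J \<Longrightarrow> convergent (c j \<circ> r)"
    using insert.IH insert.prems(2) by blast
  have "bounded (range (c i \<circ> r))"
    using insert.prems(2)[of i] by (rule bounded_subset) auto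
  then obtain a s where s: "strict_mono s" "((c i \<circ> r) \<circ> s) \<longlonglongrightarrow> a"
    using bounded_imp_convergent_subsequence by blast
  have "convergent (c j \<circ> (r \<circ> s))" if "j \<in> insert i J" for j
    using that r(2)[of j] s(2) convergent_subseq_convergent[OF _ s(1), of "c j \<circ> r"]
    by (auto simp: convergent_def o_assoc)
  then show ?case
    using insert.prems(1) strict_mono_o[OF r(1) s(1)] by blast
qed

text \<open>If the \<open>z j\<close> represent the components of an operator into a Euclidean
  space, \<open>synthesis\<close> is its adjoint, and \<open>frame_operator\<close> is the adjoint
  composed with the operator. Both \<open>gram\<close> and the discretised identity on the data
  space are of this form.\<close>

definition synthesis :: "'i set \<Rightarrow> ('i \<Rightarrow> 'a::real_inner) \<Rightarrow> ('i \<Rightarrow> real) \<Rightarrow> 'a" where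
  "synthesis J z v = (\<Sum>j\<in>J. v j *\<^sub>R z j)"

definition frame_operator :: "'i set \<Rightarrow> ('i \<Rightarrow> 'a::real_inner) \<Rightarrow> 'a \<Rightarrow> 'a" where
  "frame_operator J z x = synthesis J z (\<lambda>j. inner (z j) x)"

lemma inner_frame_operator:
  "inner (frame_operator J z x) y = (\<Sum>j\<in>J. inner (z j) x * inner (z j) y)"
  by (simp add: frame_operator_def synthesis_def inner_sum_left)

lemma frame_operator_self_adjoint:
  "inner (frame_operator J z x) y = inner x (frame_operator J z y)"
  by (simp add: inner_frame_operator inner_commute[of x] mult.commute)

lemma bounded_linear_frame_operator: "bounded_linear (frame_operator J z)"
  unfolding frame_operator_def[abs_def] synthesis_def
  by (intro bounded_linear_sum bounded_linear_scaleR_const bounded_linear_inner_right)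

lemma inner_frame_operator_nonneg: "0 \<le> inner (frame_operator J z x) x"
  by (simp add: inner_frame_operator sum_nonneg)

text \<open>The quadratic form of the frame operator is only semidefinite, but it is a Euclidean
  inner product of coefficient vectors, where Cauchy-Schwarz applies.\<close>

lemma inner_frame_operator_Cauchy_Schwarz:
  "(inner (frame_operator J z x) y)\<^sup>2
    \<le> inner (frame_operator J z x) x * inner (frame_operator J z y) y"
  using Cauchy_Schwarz_ineq_sum[of "\<lambda>j. inner (z j) x" "\<lambda>j. inner (z j) y" J]
  by (simp add: inner_frame_operator power2_eq_square)

text \<open>The eigenvector is a limit of a sequence maximising the quadratic form on the unit sphere of
  \<open>V\<close>. No compactness of the sphere is needed: the finitely many coefficients of the images
  have a convergent subsequence, and the sequence is asymptotically a multiple of its image.\<close>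

lemma frame_operator_eigenvector_exists:
  fixes z :: "'i \<Rightarrow> 'a::real_inner"
  assumes "finite J" and V: "subspace V" "closed V"
    and inv: "\<And>x. x \<in> V \<Longrightarrow> frame_operator J z x \<in> V"
    and x0: "x0 \<in> V" "frame_operator J z x0 \<noteq> 0"
  obtains x \<mu> where "x \<in> V" "norm x = 1" "0 < \<mu>" "frame_operator J z x = \<mu> *\<^sub>R x"
proof -
  define T where "T = frame_operator J z"
  interpret T: bounded_linear T
    unfolding T_def by (rule bounded_linear_frame_operator)
  note CS = inner_frame_operator_Cauchy_Schwarz[of J z, folded T_def]
  define q where "q x = inner (T x) x" for x
  define S where "S = {x \<in> V. norm x = 1}"
  define \<mu> where "\<mu> = (SUP x\<in>S. q x)"
  have "x0 \<noteq> 0"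
    using x0(2) T.zero unfolding T_def by auto
  then have x0S: "x0 /\<^sub>R norm x0 \<in> S"
    using x0(1) V(1) by (simp add: S_def subspace_scale)
  then have ne: "S \<noteq> {}"
    by blast
  have q_le: "q x \<le> onorm T" if "x \<in> S" for x
  proof -
    have "q x \<le> norm (T x) * norm x"
      unfolding q_def by (rule norm_cauchy_schwarz)
    also have "\<dots> \<le> onorm T"
      using that onorm[OF T.bounded_linear_axioms, of x] by (simp add: S_def)
    finally show ?thesis .
  qed
  have bdd: "bdd_above (q ` S)"
    using q_le by (auto intro!: bdd_aboveI2)
  have le_\<mu>: "q x \<le> \<mu>" if "x \<in> S" for x
    unfolding \<mu>_def by (rule cSUP_upper[OF that bdd])
  have q_le_\<mu>: "q x \<le> \<mu> * (norm x)\<^sup>2" if "x \<in> V" for x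
  proof (cases "x = 0")
    case False
    then have "q (x /\<^sub>R norm x) \<le> \<mu>"
      using that V(1) by (intro le_\<mu>) (simp add: S_def subspace_scale)
    then show ?thesis
      using False by (simp add: q_def T.scaleR field_simps power2_eq_square)
  qed (simp add: q_def T.zero)
  \<comment> \<open>Cauchy-Schwarz for the form at \<open>x\<close> and \<open>T x\<close>, then
    \<open>q_le_\<mu>\<close> at \<open>T x\<close>, which invariance keeps in \<open>V\<close>; a
    factor cancels.\<close>
  have T_le: "(norm (T x))\<^sup>2 \<le> \<mu> * q x" if "x \<in> V" for x
  proof (cases "T x = 0")
    case False
    have "((norm (T x))\<^sup>2)\<^sup>2 \<le> q x * q (T x)"
      using CS[of x "T x"] by (simp add: q_def power2_norm_eq_inner)
    also have "\<dots> \<le> q x * (\<mu> * (norm (T x))\<^sup>2)"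
      using inner_frame_operator_nonneg[of J z x] q_le_\<mu>[of "T x"] inv that
      by (intro mult_left_mono) (auto simp: q_def T_def)
    finally have "(norm (T x))\<^sup>2 * (norm (T x))\<^sup>2 \<le> (\<mu> * q x) * (norm (T x))\<^sup>2"
      by (simp add: power2_eq_square mult_ac)
    then show ?thesis
      by (rule mult_right_le_imp_le) (use False in simp)
  next
    case True
    then show ?thesis by (simp add: q_def)
  qed
  have "0 < \<mu>"
  proof -
    have "0 < (norm (T x0))\<^sup>2"
      using x0 by (simp add: T_def)
    then have "0 < \<mu> * q x0"
      using T_le[OF x0(1)] by linarith
    then show ?thesis
      using inner_frame_operator_nonneg[of J z x0] by (auto simp: zero_less_mult_iff q_def T_def)
  qed
  have "\<exists>x\<in>S. \<mu> - inverse (real (Suc n)) < q x" for n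
    using less_cSUP_iff[OF ne bdd, of "\<mu> - inverse (real (Suc n))"] by (simp add: \<mu>_def)
  then obtain x where x: "\<And>n. x n \<in> S" "\<And>n. \<mu> - inverse (real (Suc n)) < q (x n)"
    by metis
  have "bounded (range (\<lambda>n. inner (z j) (x n)))" for j
  proof (rule boundedI)
    fix c assume "c \<in> range (\<lambda>n. inner (z j) (x n))"
    then obtain n where "c = inner (z j) (x n)" by blast
    then show "norm c \<le> norm (z j)"
      using Cauchy_Schwarz_ineq2[of "z j" "x n"] x(1)[of n] by (simp add: S_def)
  qed
  then obtain r where r: "strict_mono r" "\<And>j. j \<in> J \<Longrightarrow> convergent ((\<lambda>n. inner (z j) (x n)) \<circ> r)"
    using bounded_family_convergent_subsequence[OF \<open>finite J\<close>, of "\<lambda>j n. inner (z j) (x n)"] by metis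
  then obtain c where c: "\<And>j. j \<in> J \<Longrightarrow> (\<lambda>n. inner (z j) (x (r n))) \<longlonglongrightarrow> c j"
    by (auto simp: convergent_def o_def) metis
  define w where "w = (\<Sum>j\<in>J. c j *\<^sub>R z j)"
  have w: "(\<lambda>n. T (x (r n))) \<longlonglongrightarrow> w"
    unfolding T_def frame_operator_def synthesis_def w_def by (intro tendsto_intros c)
  \<comment> \<open>Expanding the square and inserting \<open>T_le\<close> leaves at most
    \<open>\<mu> * (\<mu> - q (x n))\<close>, which tends to 0 along a maximising sequence.\<close>
  have "(\<lambda>n. (norm (T (x n) - \<mu> *\<^sub>R x n))\<^sup>2) \<longlonglongrightarrow> 0"
  proof (rule tendsto_sandwich[OF _ _ tendsto_const])
    have "(norm (T (x n) - \<mu> *\<^sub>R x n))\<^sup>2 \<le> \<mu> * inverse (real (Suc n))" for n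
    proof -
      have xn: "x n \<in> V" "inner (x n) (x n) = 1"
        using x(1)[of n] by (auto simp: S_def norm_eq_1)
      have "(norm (T (x n) - \<mu> *\<^sub>R x n))\<^sup>2 = (norm (T (x n)))\<^sup>2 - 2 * \<mu> * q (x n) + \<mu>\<^sup>2 * inner (x n) (x n)"
        unfolding power2_norm_eq_inner q_def
        by (simp add: inner_simps inner_commute algebra_simps power2_eq_square)
      also have "\<dots> \<le> \<mu> * (\<mu> - q (x n))"
        using T_le[OF xn(1)] xn(2) by (simp add: algebra_simps power2_eq_square)
      also have "\<dots> \<le> \<mu> * inverse (real (Suc n))"
        using x(2)[of n] \<open>0 < \<mu>\<close> by (intro mult_left_mono) auto
      finally show ?thesis .
    qed
    then show "\<forall>\<^sub>F n in sequentially. (norm (T (x n) - \<mu> *\<^sub>R x n))\<^sup>2 \<le> \<mu> * inverse (real (Suc n))"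
      by simp
    show "(\<lambda>n. \<mu> * inverse (real (Suc n))) \<longlonglongrightarrow> 0"
      using tendsto_mult[OF tendsto_const LIMSEQ_inverse_real_of_nat, of \<mu>] by simp
  qed simp
  then have "(\<lambda>n. sqrt ((norm (T (x n) - \<mu> *\<^sub>R x n))\<^sup>2)) \<longlonglongrightarrow> sqrt 0"
    by (rule tendsto_real_sqrt)
  then have "(\<lambda>n. T (x n) - \<mu> *\<^sub>R x n) \<longlonglongrightarrow> 0"
    by (simp add: tendsto_norm_zero_iff)
  then have "(\<lambda>n. T (x (r n)) - \<mu> *\<^sub>R x (r n)) \<longlonglongrightarrow> 0"
    using LIMSEQ_subseq_LIMSEQ[OF _ r(1)] by (fastforce simp: o_def)
  \<comment> \<open>This writes \<open>x (r n)\<close> through two convergent sequences, its image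
    and the defect; dividing by \<open>\<mu>\<close> is allowed since \<open>\<mu>\<close> is
    positive.\<close>
  then have "(\<lambda>n. (T (x (r n)) - (T (x (r n)) - \<mu> *\<^sub>R x (r n))) /\<^sub>R \<mu>) \<longlonglongrightarrow> (w - 0) /\<^sub>R \<mu>"
    by (intro tendsto_intros w)
  moreover define u where "u = w /\<^sub>R \<mu>"
  ultimately have lim: "(\<lambda>n. x (r n)) \<longlonglongrightarrow> u"
    using \<open>0 < \<mu>\<close> by simp
  have "u \<in> V"
    using closed_sequentially[OF V(2) _ lim] x(1) by (simp add: S_def)
  moreover have "norm u = 1"
    using LIMSEQ_unique[OF tendsto_norm[OF lim], of 1] x(1) by (simp add: S_def)
  moreover have "T u = \<mu> *\<^sub>R u"
    using LIMSEQ_unique[OF T.tendsto[OF lim] w] \<open>0 < \<mu>\<close> by (simp add: u_def)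
  ultimately show thesis
    using that \<open>0 < \<mu>\<close> by (simp add: T_def)
qed

section \<open>Finite orthonormal sets and the functional calculus\<close>

definition orthonormal_set :: "'a::real_inner set \<Rightarrow> bool" where
  "orthonormal_set B \<longleftrightarrow> (\<forall>e\<in>B. \<forall>e'\<in>B. inner e e' = of_bool (e = e'))"

lemma orthonormal_set_nonzero:
  assumes "orthonormal_set B"
  shows "0 \<notin> B"
proof
  assume "0 \<in> B"
  then have "inner (0 :: 'a) 0 = 1"
    using assms unfolding orthonormal_set_def by (metis of_bool_eq(2))
  then show False
    by simp
qed

lemma inner_sum_orthonormal:
  assumes "finite B" "orthonormal_set B" "e \<in> B"
  shows "inner e (\<Sum>e'\<in>B. c e' *\<^sub>R e') = c e"
proof -
  have "inner e (\<Sum>e'\<in>B. c e' *\<^sub>R e') = (\<Sum>e'\<in>B. if e' = e then c e' else 0)"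
    unfolding inner_sum_right
    using assms(2,3) by (intro sum.cong) (auto simp: orthonormal_set_def)
  then show ?thesis
    using assms(1,3) by simp
qed

lemma power2_norm_sum_orthonormal:
  assumes "finite B" "orthonormal_set B"
  shows "(norm (\<Sum>e\<in>B. c e *\<^sub>R e))\<^sup>2 = (\<Sum>e\<in>B. (c e)\<^sup>2)"
proof -
  have "(norm (\<Sum>e\<in>B. c e *\<^sub>R e))\<^sup>2 = (\<Sum>e\<in>B. c e * inner e (\<Sum>e'\<in>B. c e' *\<^sub>R e'))"
    by (simp add: power2_norm_eq_inner inner_sum_left)
  then show ?thesis
    by (simp add: inner_sum_orthonormal[OF assms] power2_eq_square)
qed

text \<open>Pythagoras. The remainder is kept because \<open>B\<close> need not span the
  space.\<close>

lemma power2_norm_orthonormal_split: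
  assumes "finite B" "orthonormal_set B"
  shows "(norm x)\<^sup>2 = (norm (x - (\<Sum>e\<in>B. inner e x *\<^sub>R e)))\<^sup>2 + (\<Sum>e\<in>B. (inner e x)\<^sup>2)"
proof -
  let ?p = "\<Sum>e\<in>B. inner e x *\<^sub>R e"
  have "inner ?p x = (\<Sum>e\<in>B. (inner e x)\<^sup>2)"
    by (simp add: inner_sum_left power2_eq_square)
  moreover have "inner ?p ?p = (\<Sum>e\<in>B. (inner e x)\<^sup>2)"
    using power2_norm_sum_orthonormal[OF assms, of "\<lambda>e. inner e x"] by (simp add: power2_norm_eq_inner)
  moreover have "(norm (x - p))\<^sup>2 = (norm x)\<^sup>2 - 2 * inner p x + inner p p" for p
    by (simp add: power2_norm_eq_inner inner_diff_left inner_diff_right inner_commute)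
  ultimately show ?thesis
    by simp
qed

text \<open>Makes the definite description usable: two candidates differ by an element of
  \<open>S\<close> that is orthogonal to itself.\<close>

lemma orth_proj_eqI:
  assumes "subspace S" "p \<in> S" "\<And>s. s \<in> S \<Longrightarrow> inner s (x - p) = 0"
  shows "orth_proj S x = p"
  unfolding orth_proj_def
proof (rule the_equality)
  show "p \<in> S \<and> x - p \<in> S\<^sup>\<bottom>"
    using assms by (auto simp: orthogonal_comp_def orthogonal_def)
next
  fix q assume q: "q \<in> S \<and> x - q \<in> S\<^sup>\<bottom>"
  then have "q - p \<in> S"
    using assms by (simp add: subspace_diff)
  then have "inner (q - p) (x - q) = 0" "inner (q - p) (x - p) = 0"
    using q assms(3) by (auto simp: orthogonal_comp_def orthogonal_def)
  then have "inner (q - p) ((x - p) - (x - q)) = 0"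
    by (simp only: inner_diff_right)
  then show "q = p"
    by simp
qed

text \<open>Only positive eigenvalues are recorded. The kernel, possibly of infinite dimension, is
  the orthogonal complement of \<open>B\<close>, so \<open>B\<close> stays finite.\<close>

locale spectral_decomposition =
  fixes T :: "'a::real_inner \<Rightarrow> 'a" and B :: "'a set" and eig :: "'a \<Rightarrow> real"
  assumes fin: "finite B"
    and orthonormal: "orthonormal_set B"
    and pos: "\<And>e. e \<in> B \<Longrightarrow> 0 < eig e"
    and eq: "\<And>x. T x = (\<Sum>e\<in>B. (eig e * inner e x) *\<^sub>R e)"
begin

lemma inner_T: "e \<in> B \<Longrightarrow> inner e (T x) = eig e * inner e x"
  unfolding eq by (rule inner_sum_orthonormal[OF fin orthonormal])

lemma linear_T: "linear T"
  by (rule linearI)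
    (simp_all add: eq inner_add_right algebra_simps sum.distrib scaleR_sum_right)

lemma subspace_eigenspace: "subspace (eigenspace T t)"
  unfolding subspace_def eigenspace_def
  using linear_T by (auto simp: linear_0 linear_add linear_scale algebra_simps)

lemma T_basis: "e \<in> B \<Longrightarrow> T e = eig e *\<^sub>R e"
proof -
  assume e: "e \<in> B"
  have "T e = (\<Sum>e'\<in>B. if e' = e then eig e' *\<^sub>R e' else 0)"
    unfolding eq using orthonormal e by (intro sum.cong) (auto simp: orthonormal_set_def)
  then show ?thesis
    using fin e by simp
qed

lemma eigenvalue_cases:
  assumes "T v = t *\<^sub>R v" "e \<in> B" "inner e v \<noteq> 0"
  shows "t = eig e"
  using inner_T[OF assms(2), of v] assms by simp

lemma eigenvalues_subset: "eigenvalues T \<subseteq> insert 0 (eig ` B)"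
proof
  fix t assume "t \<in> eigenvalues T"
  then obtain v where v: "v \<noteq> 0" "T v = t *\<^sub>R v"
    by (auto simp: eigenvalues_def)
  show "t \<in> insert 0 (eig ` B)"
  proof (cases "\<exists>e\<in>B. inner e v \<noteq> 0")
    case True
    then show ?thesis
      using eigenvalue_cases[OF v(2)] by blast
  next
    case False
    then have "T v = 0"
      by (simp add: eq)
    then show ?thesis
      using v by simp
  qed
qed

lemma eigenvalues_superset: "eig ` B \<subseteq> eigenvalues T"
proof
  fix t assume "t \<in> eig ` B"
  then obtain e where e: "e \<in> B" "t = eig e"
    by blast
  have "e \<noteq> 0"
    using orthonormal_set_nonzero[OF orthonormal] e(1) by blast
  with e show "t \<in> eigenvalues T"
    using T_basis by (auto simp: eigenvalues_def)
qed

lemma inner_eq_0_if_kernel: "T v = 0 \<Longrightarrow> e \<in> B \<Longrightarrow> inner e v = 0"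
  using inner_T[of e v] pos[of e] by simp

text \<open>Comparing coefficients, an eigenvector for \<open>t\<close> has nonzero coefficients
  only at those \<open>e\<close> with \<open>eig e = t\<close>; as \<open>t\<close> is nonzero it
  has no kernel part, so these \<open>e\<close> span the eigenspace.\<close>

lemma orth_proj_eigenspace_nonzero:
  assumes "t \<noteq> 0"
  shows "orth_proj (eigenspace T t) x = (\<Sum>e\<in>{e \<in> B. eig e = t}. inner e x *\<^sub>R e)"
    (is "_ = ?p")
proof (rule orth_proj_eqI[OF subspace_eigenspace])
  have "e \<in> eigenspace T t" if "e \<in> {e \<in> B. eig e = t}" for e
    using that T_basis by (auto simp: eigenspace_def)
  then show "?p \<in> eigenspace T t"
    by (intro subspace_sum subspace_scale subspace_eigenspace)
next
  fix s assume "s \<in> eigenspace T t"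
  then have s: "T s = t *\<^sub>R s"
    by (simp add: eigenspace_def)
  have "t *\<^sub>R s = (\<Sum>e\<in>B. (eig e * inner e s) *\<^sub>R e)"
    using s by (simp flip: eq)
  also have "\<dots> = (\<Sum>e\<in>{e \<in> B. eig e = t}. (t * inner e s) *\<^sub>R e)"
    using fin eigenvalue_cases[OF s] by (intro sum.mono_neutral_cong_right) auto
  also have "\<dots> = t *\<^sub>R (\<Sum>e\<in>{e \<in> B. eig e = t}. inner e s *\<^sub>R e)"
    by (simp add: scaleR_sum_right)
  finally have s_eq: "s = (\<Sum>e\<in>{e \<in> B. eig e = t}. inner e s *\<^sub>R e)"
    using assms by simp
  have on: "finite {e \<in> B. eig e = t}" "orthonormal_set {e \<in> B. eig e = t}"
    using fin orthonormal by (auto simp: orthonormal_set_def)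
  have "inner e (x - ?p) = 0" if "e \<in> {e \<in> B. eig e = t}" for e
    using inner_sum_orthonormal[OF on that, of "\<lambda>e. inner e x"] by (simp only: inner_diff_right)
  then show "inner s (x - ?p) = 0"
    by (subst s_eq, subst inner_sum_left) simp
qed

lemma orth_proj_eigenspace_0:
  assumes "x = (\<Sum>e\<in>B. inner e x *\<^sub>R e)"
  shows "orth_proj (eigenspace T 0) x = 0"
proof (rule orth_proj_eqI[OF subspace_eigenspace])
  show "0 \<in> eigenspace T 0"
    using subspace_eigenspace subspace_0 by blast
  fix s assume "s \<in> eigenspace T 0"
  then have "inner s (\<Sum>e\<in>B. inner e x *\<^sub>R e) = 0"
    using inner_eq_0_if_kernel by (simp add: eigenspace_def inner_sum_right inner_commute[of s])
  then show "inner s (x - 0) = 0"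
    using assms by simp
qed

lemma fun_calculus_eq:
  assumes "x = (\<Sum>e\<in>B. inner e x *\<^sub>R e)" \<comment> \<open>\<open>x\<close> is orthogonal to the kernel of \<open>T\<close>, so that \<open>f 0\<close> plays no role\<close>
  shows "fun_calculus f T x = (\<Sum>e\<in>B. (f (eig e) * inner e x) *\<^sub>R e)"
proof -
  have "finite (eigenvalues T)"
    using eigenvalues_subset fin finite_subset by blast
  then have "fun_calculus f T x = (\<Sum>t\<in>eigenvalues T. f t *\<^sub>R orth_proj (eigenspace T t) x)"
    by (simp add: fun_calculus_def)
  also have "\<dots> = (\<Sum>t\<in>eig ` B. f t *\<^sub>R (\<Sum>e\<in>{e \<in> B. eig e = t}. inner e x *\<^sub>R e))"
  proof (rule sum.mono_neutral_cong_right[OF \<open>finite (eigenvalues T)\<close> eigenvalues_superset])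
    show "\<forall>t\<in>eigenvalues T - eig ` B. f t *\<^sub>R orth_proj (eigenspace T t) x = 0"
      using eigenvalues_subset orth_proj_eigenspace_0[OF assms] by auto
    fix t assume "t \<in> eig ` B"
    then have "t \<noteq> 0"
      using pos by force
    then show "f t *\<^sub>R orth_proj (eigenspace T t) x
        = f t *\<^sub>R (\<Sum>e\<in>{e \<in> B. eig e = t}. inner e x *\<^sub>R e)"
      by (simp add: orth_proj_eigenspace_nonzero)
  qed
  also have "\<dots> = (\<Sum>t\<in>eig ` B. \<Sum>e\<in>{e \<in> B. eig e = t}. (f (eig e) * inner e x) *\<^sub>R e)"
    by (auto simp: scaleR_sum_right intro!: sum.cong)
  also have "\<dots> = (\<Sum>e\<in>B. (f (eig e) * inner e x) *\<^sub>R e)"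
    by (rule sum.image_gen[OF fin, symmetric])
  finally show ?thesis .
qed

end

text \<open>Take an orthonormal set of eigenvectors with positive eigenvalues of largest
  cardinality; it is bounded by \<open>card J\<close> because such eigenvectors lie in the span of
  the \<open>z j\<close>. The operator vanishes on the orthogonal complement, since otherwise an
  eigenvector there would enlarge the set.\<close>

lemma frame_operator_spectral_decomposition_exists:
  fixes z :: "'i \<Rightarrow> 'a::real_inner"
  assumes "finite J"
  obtains B eig where "spectral_decomposition (frame_operator J z) B eig"
proof -
  define T where "T = frame_operator J z"
  interpret T: bounded_linear T
    unfolding T_def by (rule bounded_linear_frame_operator)
  define P where "P B \<longleftrightarrow> orthonormal_set B \<and> (\<forall>e\<in>B. \<exists>\<mu>>0. T e = \<mu> *\<^sub>R e)" for B
  have P_bound: "finite B \<and> card B \<le> card J" if "P B" for B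
  proof -
    have "e \<in> span (z ` J)" if "e \<in> B" for e
    proof -
      have "\<exists>\<mu>>0. T e = \<mu> *\<^sub>R e"
        using \<open>P B\<close> that unfolding P_def by blast
      then obtain \<mu> where "\<mu> > 0" "T e = \<mu> *\<^sub>R e"
        by blast
      then have "e = (1 / \<mu>) *\<^sub>R T e"
        by simp
      moreover have "T e \<in> span (z ` J)"
        unfolding T_def frame_operator_def synthesis_def
        by (intro span_sum span_scale span_base) auto
      ultimately show ?thesis
        by (metis span_scale)
    qed
    moreover have "independent B"
      using \<open>P B\<close> orthonormal_set_nonzero[of B] by (intro pairwise_orthogonal_independent)
        (auto simp: P_def orthonormal_set_def pairwise_def orthogonal_def)
    ultimately have "finite B \<and> card B \<le> card (z ` J)"
      using independent_span_bound[of "z ` J" B] \<open>finite J\<close> by blast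
    then show ?thesis
      using card_image_le[OF \<open>finite J\<close>, of z] by linarith
  qed
  have "P {}"
    by (simp add: P_def orthonormal_set_def)
  moreover have "\<forall>B. P B \<longrightarrow> card B < Suc (card J)"
    using P_bound by (simp add: less_Suc_eq_le)
  ultimately have "\<exists>B. P B \<and> (\<forall>B'. P B' \<longrightarrow> card B' \<le> card B)"
    by (rule ex_has_greatest_nat)
  then obtain B where B: "P B" "\<And>B'. P B' \<Longrightarrow> card B' \<le> card B"
    by blast
  have fin: "finite B" and on: "orthonormal_set B"
    using P_bound[OF B(1)] B(1) by (auto simp: P_def)
  obtain eig where eig: "\<And>e. e \<in> B \<Longrightarrow> eig e > 0" "\<And>e. e \<in> B \<Longrightarrow> T e = eig e *\<^sub>R e"
    using B(1) unfolding P_def by metis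
  define V where "V = (\<Inter>e\<in>B. {x. inner e x = 0})"
  have V: "subspace V" "closed V"
    unfolding V_def
    by (simp add: subspace_def inner_add_right, intro closed_INT ballI closed_hyperplane)
  have inv: "T x \<in> V" if "x \<in> V" for x
  proof -
    have "inner e (T x) = 0" if "e \<in> B" for e
    proof -
      have "inner e (T x) = eig e * inner e x"
        using frame_operator_self_adjoint[of J z e x] eig(2)[OF that]
        by (simp add: T_def)
      then show ?thesis
        using \<open>x \<in> V\<close> that by (simp add: V_def)
    qed
    then show ?thesis
      by (simp add: V_def)
  qed
  have T0: "T x = 0" if "x \<in> V" for x
  proof (rule ccontr)
    assume "T x \<noteq> 0"
    then obtain e \<mu> where e: "e \<in> V" "norm e = 1" "0 < \<mu>" "T e = \<mu> *\<^sub>R e"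
      using frame_operator_eigenvector_exists[OF \<open>finite J\<close> V inv[unfolded T_def] \<open>x \<in> V\<close>
          \<open>T x \<noteq> 0\<close>[unfolded T_def]] unfolding T_def by blast
    have "e \<notin> B"
      using e(1,2) by (auto simp: V_def)
    have "P (insert e B)"
      using e on B(1) by (auto simp: P_def orthonormal_set_def V_def norm_eq_1 inner_commute)
    then show False
      using B(2)[of "insert e B"] fin \<open>e \<notin> B\<close> by simp
  qed
  have "T x = (\<Sum>e\<in>B. (eig e * inner e x) *\<^sub>R e)" for x
  proof -
    have "inner e (x - (\<Sum>e\<in>B. inner e x *\<^sub>R e)) = 0" if "e \<in> B" for e
      using inner_sum_orthonormal[OF fin on that, of "\<lambda>e. inner e x"] by (simp only: inner_diff_right)
    then have "x - (\<Sum>e\<in>B. inner e x *\<^sub>R e) \<in> V"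
      by (simp add: V_def)
    then have "T x = T (\<Sum>e\<in>B. inner e x *\<^sub>R e)"
      using T0[of "x - (\<Sum>e\<in>B. inner e x *\<^sub>R e)"] by (simp only: T.diff right_minus_eq)
    then show ?thesis
      using eig(2) by (simp add: T.sum T.scaleR mult.commute)
  qed
  then have "spectral_decomposition T B eig"
    using fin on eig(1) by unfold_locales
  then show thesis
    using that unfolding T_def by blast
qed

text \<open>The remainder \<open>y\<close> is orthogonal to \<open>B\<close>, hence in the kernel of
  the frame operator. Its quadratic form, a sum of squares, then vanishes, so \<open>y\<close> is
  orthogonal to every \<open>z j\<close> and thus to \<open>synthesis J z v\<close>. This supplies
  the premise of \<open>fun_calculus_eq\<close>.\<close>

lemma synthesis_expansion:
  assumes "spectral_decomposition (frame_operator J z) B eig" "finite J"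
  shows "synthesis J z v = (\<Sum>e\<in>B. inner e (synthesis J z v) *\<^sub>R e)"
proof -
  interpret spectral_decomposition "frame_operator J z" B eig by fact
  let ?x = "synthesis J z v"
  define y where "y = ?x - (\<Sum>e\<in>B. inner e ?x *\<^sub>R e)"
  have e0: "inner e y = 0" if "e \<in> B" for e
    unfolding y_def inner_diff_right inner_sum_orthonormal[OF fin orthonormal that] by simp
  then have "frame_operator J z y = 0"
    by (simp add: eq)
  then have "(\<Sum>j\<in>J. (inner (z j) y)\<^sup>2) = 0"
    using inner_frame_operator[of J z y y] by (simp add: power2_eq_square)
  then have "inner (z j) y = 0" if "j \<in> J" for j
    using that \<open>finite J\<close> by (simp add: sum_nonneg_eq_0_iff)
  then have "inner ?x y = 0"
    by (simp add: synthesis_def inner_sum_left)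
  moreover have "inner (\<Sum>e\<in>B. inner e ?x *\<^sub>R e) y = 0"
    using e0 by (simp add: inner_sum_left)
  ultimately have "inner y y = 0"
    by (subst y_def) (simp add: inner_diff_left)
  then show ?thesis
    by (simp add: y_def)
qed

section \<open>Additivity and norm bounds of the functional calculus\<close>

lemma synthesis_add: "synthesis J z (\<lambda>j. v j + w j) = synthesis J z v + synthesis J z w"
  by (simp add: synthesis_def scaleR_add_left sum.distrib)

lemma fun_calculus_synthesis_add:
  assumes "finite J"
  shows "fun_calculus f (frame_operator J z) (synthesis J z v + synthesis J z w) =
    fun_calculus f (frame_operator J z) (synthesis J z v) +
    fun_calculus f (frame_operator J z) (synthesis J z w)"
proof -
  obtain B eig where D: "spectral_decomposition (frame_operator J z) B eig"
    using frame_operator_spectral_decomposition_exists[OF assms] .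
  note eq = spectral_decomposition.fun_calculus_eq[OF D synthesis_expansion[OF D assms]]
  show ?thesis
    by (simp add: eq eq[of _ "\<lambda>j. v j + w j", unfolded synthesis_add] inner_add_right algebra_simps
        sum.distrib)
qed

text \<open>The noise bound, by duality: the squared norm of the result \<open>u\<close> is the
  Euclidean product of \<open>v\<close> with the coefficients of \<open>w\<close>, whose squared
  length is the quadratic form at \<open>w\<close>. The absolute value covers an empty interval, for
  which \<open>S\<close> may be negative.\<close>

lemma norm_fun_calculus_synthesis_le:
  assumes "finite J" and spec: "eigenvalues (frame_operator J z) \<subseteq> {0..\<kappa>}"
    and f: "\<And>t. t \<in> {0<..\<kappa>} \<Longrightarrow> t * (f t)\<^sup>2 \<le> S"
  shows "(norm (fun_calculus f (frame_operator J z) (synthesis J z v)))\<^sup>2 \<le> \<bar>S\<bar> * (\<Sum>j\<in>J. (v j)\<^sup>2)"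
proof -
  obtain B eig where D: "spectral_decomposition (frame_operator J z) B eig"
    using frame_operator_spectral_decomposition_exists[OF assms(1)] .
  interpret spectral_decomposition "frame_operator J z" B eig by fact
  define c where "c e = f (eig e) * inner e (synthesis J z v)" for e
  define u where "u = (\<Sum>e\<in>B. c e *\<^sub>R e)"
  \<comment> \<open>This is \<open>f\<close> of the frame operator applied to \<open>u\<close>,
    which moves one factor \<open>f\<close> to the other side of the inner product.\<close>
  define w where "w = (\<Sum>e\<in>B. (f (eig e) * c e) *\<^sub>R e)"
  have u_eq: "fun_calculus f (frame_operator J z) (synthesis J z v) = u"
    unfolding u_def c_def by (rule fun_calculus_eq[OF synthesis_expansion[OF D assms(1)]])
  have norm_u: "(norm u)\<^sup>2 = (\<Sum>e\<in>B. (c e)\<^sup>2)"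
    unfolding u_def by (rule power2_norm_sum_orthonormal[OF fin orthonormal])
  have u_w: "(norm u)\<^sup>2 = (\<Sum>j\<in>J. v j * inner (z j) w)"
  proof -
    have "(\<Sum>j\<in>J. v j * inner (z j) w) = inner (synthesis J z v) w"
      by (simp add: synthesis_def inner_sum_left)
    also have "\<dots> = (\<Sum>e\<in>B. f (eig e) * c e * inner e (synthesis J z v))"
      by (simp add: w_def inner_sum_right inner_commute)
    also have "\<dots> = (norm u)\<^sup>2"
      unfolding norm_u by (simp add: c_def power2_eq_square mult_ac)
    finally show ?thesis ..
  qed
  have "(\<Sum>j\<in>J. (inner (z j) w)\<^sup>2) = inner w (frame_operator J z w)"
    by (simp add: inner_frame_operator power2_eq_square inner_commute[of w])
  also have "\<dots> = (\<Sum>e\<in>B. f (eig e) * c e * inner e (frame_operator J z w))"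
    by (simp add: inner_sum_left w_def)
  also have "\<dots> = (\<Sum>e\<in>B. (eig e * (f (eig e))\<^sup>2) * (c e)\<^sup>2)"
  proof (rule sum.cong[OF refl])
    fix e assume "e \<in> B"
    then have "inner e (frame_operator J z w) = eig e * (f (eig e) * c e)"
      by (simp add: inner_T w_def inner_sum_orthonormal[OF fin orthonormal])
    then show "f (eig e) * c e * inner e (frame_operator J z w) = (eig e * (f (eig e))\<^sup>2) * (c e)\<^sup>2"
      by (simp add: power2_eq_square)
  qed
  also have "\<dots> \<le> (\<Sum>e\<in>B. \<bar>S\<bar> * (c e)\<^sup>2)"
  proof (intro sum_mono mult_right_mono)
    fix e assume "e \<in> B"
    then have "eig e \<in> {0<..\<kappa>}"
      using spec eigenvalues_superset pos by force
    then show "eig e * (f (eig e))\<^sup>2 \<le> \<bar>S\<bar>"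
      using f by force
  qed simp
  also have "\<dots> = \<bar>S\<bar> * (norm u)\<^sup>2"
    by (simp add: norm_u sum_distrib_left)
  finally have "(\<Sum>j\<in>J. (inner (z j) w)\<^sup>2) \<le> \<bar>S\<bar> * (norm u)\<^sup>2" .
  moreover have "((norm u)\<^sup>2)\<^sup>2 \<le> (\<Sum>j\<in>J. (v j)\<^sup>2) * (\<Sum>j\<in>J. (inner (z j) w)\<^sup>2)"
    unfolding u_w by (rule Cauchy_Schwarz_ineq_sum)
  ultimately have "((norm u)\<^sup>2)\<^sup>2 \<le> (\<Sum>j\<in>J. (v j)\<^sup>2) * (\<bar>S\<bar> * (norm u)\<^sup>2)"
    by (meson mult_left_mono order_trans sum_nonneg zero_le_power2)
  then have *: "(norm u)\<^sup>2 * (norm u)\<^sup>2 \<le> (\<bar>S\<bar> * (\<Sum>j\<in>J. (v j)\<^sup>2)) * (norm u)\<^sup>2"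
    by (simp add: power2_eq_square mult_ac)
  show ?thesis
  proof (cases "u = 0")
    case True
    then show ?thesis
      by (simp add: u_eq sum_nonneg)
  next
    case False
    show ?thesis
      unfolding u_eq by (rule mult_right_le_imp_le[OF *]) (use False in simp)
  qed
qed

text \<open>On the kernel the residual is minus the identity, whence \<open>1 \<le> C\<close>; on
  \<open>B\<close> it multiplies each coefficient by a number of modulus at most
  \<open>C\<close>.\<close>

lemma norm_residual_le:
  assumes "finite J" and spec: "eigenvalues (frame_operator J z) \<subseteq> {0..\<kappa>}"
    and f: "\<And>t. t \<in> {0<..\<kappa>} \<Longrightarrow> \<bar>1 - f t * t\<bar> \<le> C" and "1 \<le> C"
  shows "norm (fun_calculus f (frame_operator J z) (frame_operator J z x) - x) \<le> C * norm x"
proof -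
  obtain B eig where D: "spectral_decomposition (frame_operator J z) B eig"
    using frame_operator_spectral_decomposition_exists[OF assms(1)] .
  interpret spectral_decomposition "frame_operator J z" B eig by fact
  define u where "u = fun_calculus f (frame_operator J z) (frame_operator J z x)"
  have u_eq: "u = (\<Sum>e\<in>B. (f (eig e) * (eig e * inner e x)) *\<^sub>R e)"
    unfolding u_def fun_calculus_eq[OF synthesis_expansion[OF D assms(1), of "\<lambda>j. inner (z j) x"],
        folded frame_operator_def]
    by (simp add: inner_T)
  have u_inner: "inner e u = f (eig e) * (eig e * inner e x)" if "e \<in> B" for e
    unfolding u_eq by (rule inner_sum_orthonormal[OF fin orthonormal that])
  have "(\<Sum>e\<in>B. inner e u *\<^sub>R e) = u"
    using u_inner by (simp add: u_eq)
  then have "(norm (u - x - (\<Sum>e\<in>B. inner e (u - x) *\<^sub>R e)))\<^sup>2 = (norm (x - (\<Sum>e\<in>B. inner e x *\<^sub>R e)))\<^sup>2"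
    by (simp add: inner_diff_right algebra_simps sum_subtractf norm_minus_commute)
  also have "\<dots> \<le> C\<^sup>2 * (norm (x - (\<Sum>e\<in>B. inner e x *\<^sub>R e)))\<^sup>2"
    using power_mono[OF \<open>1 \<le> C\<close>, of 2] by (simp add: mult_le_cancel_right1)
  finally have 1: "(norm (u - x - (\<Sum>e\<in>B. inner e (u - x) *\<^sub>R e)))\<^sup>2
      \<le> C\<^sup>2 * (norm (x - (\<Sum>e\<in>B. inner e x *\<^sub>R e)))\<^sup>2" .
  have 2: "(\<Sum>e\<in>B. (inner e (u - x))\<^sup>2) \<le> (\<Sum>e\<in>B. C\<^sup>2 * (inner e x)\<^sup>2)"
  proof (rule sum_mono)
    fix e assume e: "e \<in> B"
    then have "eig e \<in> {0<..\<kappa>}"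
      using spec eigenvalues_superset pos by force
    then have "(1 - f (eig e) * eig e)\<^sup>2 \<le> C\<^sup>2"
      using f \<open>1 \<le> C\<close> by (simp add: abs_le_square_iff[symmetric])
    then have "(1 - f (eig e) * eig e)\<^sup>2 * (inner e x)\<^sup>2 \<le> C\<^sup>2 * (inner e x)\<^sup>2"
      by (rule mult_right_mono) simp
    moreover have "inner e (u - x) = - ((1 - f (eig e) * eig e) * inner e x)"
      using u_inner[OF e] by (simp add: inner_diff_right algebra_simps)
    ultimately show "(inner e (u - x))\<^sup>2 \<le> C\<^sup>2 * (inner e x)\<^sup>2"
      by (simp add: power_mult_distrib)
  qed
  have "(norm (u - x))\<^sup>2 \<le> C\<^sup>2 * (norm x)\<^sup>2"
    using 1 2 power2_norm_orthonormal_split[OF fin orthonormal, of x]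
      power2_norm_orthonormal_split[OF fin orthonormal, of "u - x"]
    by (simp add: algebra_simps sum_distrib_left)
  then have "(norm (u - x))\<^sup>2 \<le> (C * norm x)\<^sup>2"
    by (simp add: power_mult_distrib)
  then have "norm (u - x) \<le> C * norm x"
    by (rule power2_le_imp_le) (use \<open>1 \<le> C\<close> in simp)
  then show ?thesis
    by (simp only: u_def)
qed

text \<open>Vectors in the range of the frame operator have no kernel component, so only the factors
  \<open>t * (1 - f t * t)\<close> occur and \<open>s\<close> may be small.\<close>

lemma norm_residual_frame_operator_le:
  assumes "finite J" and spec: "eigenvalues (frame_operator J z) \<subseteq> {0..\<kappa>}"
    and f: "\<And>t. t \<in> {0<..\<kappa>} \<Longrightarrow> t * \<bar>1 - f t * t\<bar> \<le> s" and "0 \<le> s"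
  shows "norm (fun_calculus f (frame_operator J z) (frame_operator J z (frame_operator J z x))
    - frame_operator J z x) \<le> s * norm x"
proof -
  obtain B eig where D: "spectral_decomposition (frame_operator J z) B eig"
    using frame_operator_spectral_decomposition_exists[OF assms(1)] .
  interpret spectral_decomposition "frame_operator J z" B eig by fact
  define u where "u = fun_calculus f (frame_operator J z) (frame_operator J z (frame_operator J z x))
    - frame_operator J z x"
  have "u = (\<Sum>e\<in>B. (f (eig e) * (eig e * (eig e * inner e x))) *\<^sub>R e) - frame_operator J z x"
    unfolding u_def fun_calculus_eq[OF synthesis_expansion[OF D assms(1),
          of "\<lambda>j. inner (z j) (frame_operator J z x)"], folded frame_operator_def]
    by (simp add: inner_T)
  then have "u = (\<Sum>e\<in>B. (- (eig e * (1 - f (eig e) * eig e)) * inner e x) *\<^sub>R e)"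
    by (simp add: eq[of x] sum_subtractf[symmetric] algebra_simps)
  then have "(norm u)\<^sup>2 = (\<Sum>e\<in>B. (- (eig e * (1 - f (eig e) * eig e)) * inner e x)\<^sup>2)"
    using power2_norm_sum_orthonormal[OF fin orthonormal] by (simp only:)
  also have "\<dots> = (\<Sum>e\<in>B. (eig e * (1 - f (eig e) * eig e))\<^sup>2 * (inner e x)\<^sup>2)"
    by (simp add: power_mult_distrib)
  also have "\<dots> \<le> (\<Sum>e\<in>B. s\<^sup>2 * (inner e x)\<^sup>2)"
  proof (intro sum_mono mult_right_mono)
    fix e assume e: "e \<in> B"
    then have "eig e \<in> {0<..\<kappa>}"
      using spec eigenvalues_superset pos by force
    then show "(eig e * (1 - f (eig e) * eig e))\<^sup>2 \<le> s\<^sup>2"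
      using f[of "eig e"] \<open>0 \<le> s\<close> by (simp add: abs_le_square_iff[symmetric] abs_mult)
  qed simp
  also have "\<dots> \<le> s\<^sup>2 * (norm x)\<^sup>2"
    using power2_norm_orthonormal_split[OF fin orthonormal, of x]
    by (simp add: sum_distrib_left[symmetric] mult_left_mono)
  finally have "(norm u)\<^sup>2 \<le> (s * norm x)\<^sup>2"
    by (simp add: power_mult_distrib)
  then have "norm u \<le> s * norm x"
    by (rule power2_le_imp_le) (use \<open>0 \<le> s\<close> in simp)
  then show ?thesis
    by (simp only: u_def)
qed

section \<open>Filters and convergence of the bias\<close>

text \<open>The case \<open>\<nu> = 0\<close> of the qualification estimate, where both powers are
  1. The constant is raised to at least 1 for \<open>norm_residual_le\<close>.\<close>

lemma regularising_filter_residual_bounded: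
  assumes "regularising_filter \<kappa> F \<nu>0"
  obtains C where "1 \<le> C" "\<And>\<alpha> t. 0 < \<alpha> \<Longrightarrow> t \<in> {0<..\<kappa>} \<Longrightarrow> \<bar>1 - F \<alpha> t * t\<bar> \<le> C"
proof -
  have "0 \<le> (0::real) \<and> ereal 0 \<le> \<nu>0" and qual: "qualification_bound \<kappa> F \<nu>0"
    using assms by (auto simp: regularising_filter_def has_qualification_def zero_ereal_def)
  from qual[unfolded qualification_bound_def, rule_format, OF this(1)]
  obtain C where C: "\<And>\<alpha> t. 0 < \<alpha> \<Longrightarrow> t \<in> {0<..\<kappa>} \<Longrightarrow>
      t powr (0 / 2) * \<bar>1 - F \<alpha> t * t\<bar> \<le> C * \<alpha> powr (0 / 2)"
    by blast
  have "\<bar>1 - F \<alpha> t * t\<bar> \<le> max 1 C" if "0 < \<alpha>" "t \<in> {0<..\<kappa>}" for \<alpha> t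
    using C[OF that] that by auto
  then show thesis
    using that[of "max 1 C"] by simp
qed

lemma regularising_filter_square_bound:
  assumes "regularising_filter \<kappa> F \<nu>0"
  obtains C where "0 \<le> C" "\<And>\<alpha> t. 0 < \<alpha> \<Longrightarrow> t \<in> {0<..\<kappa>} \<Longrightarrow> t * (F \<alpha> t)\<^sup>2 \<le> C / \<alpha>"
proof -
  obtain C\<^sub>R C\<^sub>F where R: "\<And>\<alpha> t. 0 < \<alpha> \<Longrightarrow> t \<in> {0<..\<kappa>} \<Longrightarrow> t * \<bar>F \<alpha> t\<bar> \<le> C\<^sub>R"
    and F: "\<And>\<alpha> t. 0 < \<alpha> \<Longrightarrow> t \<in> {0<..\<kappa>} \<Longrightarrow> \<bar>F \<alpha> t\<bar> \<le> C\<^sub>F / \<alpha>"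
    using assms unfolding regularising_filter_def by blast
  have "t * (F \<alpha> t)\<^sup>2 \<le> \<bar>C\<^sub>R\<bar> * \<bar>C\<^sub>F\<bar> / \<alpha>" if "0 < \<alpha>" "t \<in> {0<..\<kappa>}" for \<alpha> t
  proof -
    have "t * \<bar>F \<alpha> t\<bar> \<le> \<bar>C\<^sub>R\<bar>"
      using R[OF that] by linarith
    moreover have "\<bar>F \<alpha> t\<bar> \<le> \<bar>C\<^sub>F\<bar> / \<alpha>"
      using F[OF that] divide_right_mono[of C\<^sub>F "\<bar>C\<^sub>F\<bar>" \<alpha>] that(1) by linarith
    ultimately have "(t * \<bar>F \<alpha> t\<bar>) * \<bar>F \<alpha> t\<bar> \<le> \<bar>C\<^sub>R\<bar> * (\<bar>C\<^sub>F\<bar> / \<alpha>)"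
      by (rule mult_mono) auto
    then show ?thesis
      by (simp add: power2_eq_square mult.assoc)
  qed
  then show thesis
    using that[of "\<bar>C\<^sub>R\<bar> * \<bar>C\<^sub>F\<bar>"] by simp
qed

text \<open>The qualification may be 0 and then gives no decay, so condition (i) is used instead.
  Below \<open>\<epsilon>\<close> the factor \<open>t\<close> compensates the bounded residual;
  above it the filter converges uniformly.\<close>

lemma regularising_filter_eventually_small:
  assumes filter: "regularising_filter \<kappa> F \<nu>0" and "0 < \<eta>"
  shows "\<forall>\<^sub>F \<alpha> in at_right 0. \<forall>t\<in>{0<..\<kappa>}. t * \<bar>1 - F \<alpha> t * t\<bar> \<le> \<eta>"
proof -
  obtain C where C: "1 \<le> C" "\<And>\<alpha> t. 0 < \<alpha> \<Longrightarrow> t \<in> {0<..\<kappa>} \<Longrightarrow> \<bar>1 - F \<alpha> t * t\<bar> \<le> C"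
    using regularising_filter_residual_bounded[OF filter] by blast
  define \<epsilon> where "\<epsilon> = \<eta> / C"
  have "0 < \<epsilon>"
    using C(1) \<open>0 < \<eta>\<close> by (simp add: \<epsilon>_def)
  \<comment> \<open>The residual term equals the square of \<open>t\<close> times
    \<open>\<bar>F \<alpha> t - 1 / t\<bar>\<close>, hence the square of \<open>\<kappa>\<close>;
    adding 1 keeps the denominator positive.\<close>
  moreover have "0 < \<eta> / (\<kappa>\<^sup>2 + 1)"
    using \<open>0 < \<eta>\<close> by (simp add: add_nonneg_pos)
  ultimately have "\<forall>\<^sub>F \<alpha> in at_right 0. \<forall>t\<in>{\<epsilon>..\<kappa>}. dist (F \<alpha> t) (1 / t) < \<eta> / (\<kappa>\<^sup>2 + 1)"
    using filter unfolding regularising_filter_def by (blast dest: uniform_limitD)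
  moreover have "\<forall>\<^sub>F \<alpha> in at_right (0::real). 0 < \<alpha>"
    by (rule eventually_at_right_less)
  ultimately show ?thesis
  proof eventually_elim
    case (elim \<alpha>)
    show ?case
    proof
      fix t assume t: "t \<in> {0<..\<kappa>}"
      show "t * \<bar>1 - F \<alpha> t * t\<bar> \<le> \<eta>"
      proof (cases "t < \<epsilon>")
        case True
        then have "t * \<bar>1 - F \<alpha> t * t\<bar> \<le> \<epsilon> * C"
          using t C(2)[OF elim(2) t] by (intro mult_mono) auto
        then show ?thesis
          using C(1) by (simp add: \<epsilon>_def)
      next
        case False
        then have "dist (F \<alpha> t) (1 / t) < \<eta> / (\<kappa>\<^sup>2 + 1)"
          using elim(1) t by simp
        then have "\<bar>F \<alpha> t - 1 / t\<bar> \<le> \<eta> / (\<kappa>\<^sup>2 + 1)"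
          by (simp add: dist_real_def)
        moreover have "t\<^sup>2 \<le> \<kappa>\<^sup>2"
          using t by (intro power_mono) auto
        then have "t\<^sup>2 \<le> \<kappa>\<^sup>2 + 1"
          by simp
        ultimately have "t\<^sup>2 * \<bar>F \<alpha> t - 1 / t\<bar> \<le> (\<kappa>\<^sup>2 + 1) * (\<eta> / (\<kappa>\<^sup>2 + 1))"
          by (intro mult_mono) auto
        also have "\<dots> = \<eta>"
          using add_nonneg_pos[of "\<kappa>\<^sup>2" 1] by simp
        also have "t\<^sup>2 * \<bar>F \<alpha> t - 1 / t\<bar> = t * \<bar>t * (F \<alpha> t - 1 / t)\<bar>"
          using t by (simp add: abs_mult power2_eq_square)
        also have "t * (F \<alpha> t - 1 / t) = F \<alpha> t * t - 1"
          using t by (simp add: field_simps)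
        finally show ?thesis
          by (simp only: abs_minus_commute)
      qed
    qed
  qed
qed

section \<open>Strong limits of frame operators and of the residual\<close>

lemma frame_operator_limit_self_adjoint:
  assumes "\<And>x. (\<lambda>m. frame_operator (J m) (z m) x) \<longlonglongrightarrow> A x"
  shows "inner (A x) y = inner x (A y)"
proof (rule LIMSEQ_unique)
  show "(\<lambda>m. inner (frame_operator (J m) (z m) x) y) \<longlonglongrightarrow> inner (A x) y"
    by (intro tendsto_intros assms)
  show "(\<lambda>m. inner (frame_operator (J m) (z m) x) y) \<longlonglongrightarrow> inner x (A y)"
    unfolding frame_operator_self_adjoint by (intro tendsto_intros assms)
qed

text \<open>With \<open>y = A x\<close> this shows that \<open>inner (A x) x = 0\<close> forces
  \<open>A x = 0\<close>, without a square root of \<open>A\<close>.\<close>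

lemma frame_operator_limit_Cauchy_Schwarz:
  assumes "\<And>x. (\<lambda>m. frame_operator (J m) (z m) x) \<longlonglongrightarrow> A x"
  shows "(inner (A x) y)\<^sup>2 \<le> inner (A x) x * inner (A y) y"
proof (rule LIMSEQ_le)
  show "(\<lambda>m. (inner (frame_operator (J m) (z m) x) y)\<^sup>2) \<longlonglongrightarrow> (inner (A x) y)\<^sup>2"
    by (intro tendsto_intros assms)
  show "(\<lambda>m. inner (frame_operator (J m) (z m) x) x * inner (frame_operator (J m) (z m) y) y)
      \<longlonglongrightarrow> inner (A x) x * inner (A y) y"
    by (intro tendsto_intros assms)
qed (use inner_frame_operator_Cauchy_Schwarz in blast)

text \<open>The approximating \<open>w\<close> depends on \<open>x\<close> and \<open>e\<close> but
  not on \<open>p\<close>. Hence discretisation and parameter may pass to the limit together with no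
  relation between \<open>M\<close> and \<open>a\<close>.\<close>

lemma residual_tendsto_0:
  fixes G :: "'a::real_inner \<Rightarrow> 'a" and M :: "'p \<Rightarrow> nat"
  assumes J: "\<And>m. finite (J m)"
    and spec: "\<And>m. 1 \<le> m \<Longrightarrow> eigenvalues (frame_operator (J m) (z m)) \<subseteq> {0..\<kappa>}"
    and lim: "\<And>x. (\<lambda>m. frame_operator (J m) (z m) x) \<longlonglongrightarrow> G x"
    and dense: "closure (range G) = UNIV"
    and filter: "regularising_filter \<kappa> F \<nu>0"
    and a: "filterlim a (at_right 0) \<Phi>"
    and M: "filterlim M sequentially \<Phi>"
  shows "((\<lambda>p. fun_calculus (F (a p)) (frame_operator (J (M p)) (z (M p)))
      (frame_operator (J (M p)) (z (M p)) x) - x) \<longlongrightarrow> 0) \<Phi>"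
proof (rule tendstoI)
  fix e :: real assume "0 < e"
  define T where "T m = frame_operator (J m) (z m)" for m
  define r where "r p y = fun_calculus (F (a p)) (T (M p)) (T (M p) y) - y" for p y
  obtain C where C: "1 \<le> C" "\<And>\<alpha> t. 0 < \<alpha> \<Longrightarrow> t \<in> {0<..\<kappa>} \<Longrightarrow> \<bar>1 - F \<alpha> t * t\<bar> \<le> C"
    using regularising_filter_residual_bounded[OF filter] by blast
  have "0 < e / (2 * C)"
    using C(1) \<open>0 < e\<close> by simp
  then obtain w where w: "dist (G w) x < e / (2 * C)"
    using dense closure_approachable[of x "range G"] by blast
  define s where "s = e / (2 * (norm w + 1))"
  have "0 < norm w + 1"
    by (simp add: add_nonneg_pos)
  then have "0 < s" and s: "s * norm w < e / 2"
    using \<open>0 < e\<close> by (simp_all add: s_def field_simps)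
  have r_add: "r p (x + y) = r p x + r p y" for p x y
  proof -
    have "T (M p) (x + y) = T (M p) x + T (M p) y"
      unfolding T_def using bounded_linear_frame_operator by (rule bounded_linear.linear[THEN linear_add])
    moreover have "fun_calculus (F (a p)) (T (M p)) (T (M p) x + T (M p) y)
        = fun_calculus (F (a p)) (T (M p)) (T (M p) x) + fun_calculus (F (a p)) (T (M p)) (T (M p) y)"
      unfolding T_def frame_operator_def[of _ _ x] frame_operator_def[of _ _ y]
      by (rule fun_calculus_synthesis_add[OF J])
    ultimately show ?thesis
      by (simp add: r_def)
  qed
  have "(\<lambda>m. dist (T m w) x) \<longlonglongrightarrow> dist (G w) x"
    unfolding T_def by (intro tendsto_intros lim)
  then have "\<forall>\<^sub>F m in sequentially. dist (T m w) x < e / (2 * C)"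
    using w by (rule order_tendstoD)
  then have "\<forall>\<^sub>F p in \<Phi>. dist (T (M p) w) x < e / (2 * C)"
    using M by (rule eventually_compose_filterlim)
  moreover have "\<forall>\<^sub>F p in \<Phi>. 1 \<le> M p"
    using eventually_ge_at_top M by (rule eventually_compose_filterlim)
  moreover have "\<forall>\<^sub>F p in \<Phi>. \<forall>t\<in>{0<..\<kappa>}. t * \<bar>1 - F (a p) t * t\<bar> \<le> s"
    using regularising_filter_eventually_small[OF filter \<open>0 < s\<close>] a
    by (rule eventually_compose_filterlim)
  moreover have "\<forall>\<^sub>F p in \<Phi>. 0 < a p"
    using eventually_at_right_less a by (rule eventually_compose_filterlim)
  ultimately have "\<forall>\<^sub>F p in \<Phi>. norm (r p x) < e"
  proof eventually_elim
    case (elim p)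
    have "norm (r p (x - T (M p) w)) \<le> C * norm (x - T (M p) w)"
      unfolding r_def T_def
      by (rule norm_residual_le[OF J spec[OF elim(2)] C(2)[OF elim(4)] C(1)])
    also have "\<dots> < e / 2"
      using elim(1) C(1) by (simp add: dist_norm norm_minus_commute field_simps)
    finally have 1: "norm (r p (x - T (M p) w)) < e / 2" .
    have "norm (r p (T (M p) w)) \<le> s * norm w"
      unfolding r_def T_def
      using elim(3) \<open>0 < s\<close> by (intro norm_residual_frame_operator_le[OF J spec[OF elim(2)]]) auto
    then have "norm (r p (T (M p) w)) < e / 2"
      using s by linarith
    moreover have "norm (r p (x - T (M p) w + T (M p) w))
        \<le> norm (r p (x - T (M p) w)) + norm (r p (T (M p) w))"
      unfolding r_add by (rule norm_triangle_ineq)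
    ultimately show ?case
      using 1 by simp
  qed
  then show "\<forall>\<^sub>F p in \<Phi>. dist (fun_calculus (F (a p)) (frame_operator (J (M p)) (z (M p)))
      (frame_operator (J (M p)) (z (M p)) x) - x) 0 < e"
    by (simp add: r_def T_def)
qed

section \<open>Averaged noise, discretisation and the joint limit\<close>

text \<open>Independence and zero means kill the mixed products, so variances add. The bounds on the
  nonnegative integrals already give square integrability.\<close>

lemma (in prob_space) nn_integral_square_sum_indep_le:
  fixes X :: "'i \<Rightarrow> 'a \<Rightarrow> real" and C :: real
  assumes indep: "indep_vars (\<lambda>_. borel) X I" and "finite I"
    and int: "\<And>i. i \<in> I \<Longrightarrow> integrable M (X i)"
    and mean: "\<And>i. i \<in> I \<Longrightarrow> expectation (X i) = 0"
    and var: "\<And>i. i \<in> I \<Longrightarrow> (\<integral>\<^sup>+\<omega>. ennreal ((X i \<omega>)\<^sup>2) \<partial>M) \<le> ennreal C" and "0 \<le> C"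
  shows "(\<integral>\<^sup>+\<omega>. ennreal ((\<Sum>i\<in>I. X i \<omega>)\<^sup>2) \<partial>M) \<le> ennreal (real (card I) * C)"
proof -
  have sq_int: "integrable M (\<lambda>\<omega>. X i \<omega> * X i \<omega>)" if "i \<in> I" for i
  proof (rule integrableI_bounded)
    show "(\<lambda>\<omega>. X i \<omega> * X i \<omega>) \<in> borel_measurable M"
      using int[OF that] by measurable
    show "(\<integral>\<^sup>+\<omega>. ennreal (norm (X i \<omega> * X i \<omega>)) \<partial>M) < \<infinity>"
      using var[OF that] by (simp add: power2_eq_square abs_mult_self_eq order_le_less_trans flip: abs_mult)
  qed
  have sq_le: "expectation (\<lambda>\<omega>. X i \<omega> * X i \<omega>) \<le> C" if "i \<in> I" for i
    using var[OF that] nn_integral_eq_integral[OF sq_int[OF that]] \<open>0 \<le> C\<close>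
    by (simp add: power2_eq_square)
  have cross: "integrable M (\<lambda>\<omega>. X i \<omega> * X k \<omega>) \<and> expectation (\<lambda>\<omega>. X i \<omega> * X k \<omega>) = 0"
    if ik: "i \<in> I" "k \<in> I" "i \<noteq> k" for i k
  proof -
    have "indep_vars (\<lambda>_. borel) X {i, k}"
      by (rule indep_vars_subset[OF indep]) (use ik in simp)
    note * = indep_vars_lebesgue_integral[OF _ this] indep_vars_integrable[OF _ this]
    show ?thesis
      using * int mean ik by auto
  qed
  have prod_int: "integrable M (\<lambda>\<omega>. X i \<omega> * X k \<omega>)" if "i \<in> I" "k \<in> I" for i k
    using sq_int cross that by (cases "i = k") auto
  have eq: "(\<Sum>i\<in>I. X i \<omega>)\<^sup>2 = (\<Sum>i\<in>I. \<Sum>k\<in>I. X i \<omega> * X k \<omega>)" for \<omega>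
    by (simp add: power2_eq_square sum_product)
  have "(\<integral>\<^sup>+\<omega>. ennreal ((\<Sum>i\<in>I. X i \<omega>)\<^sup>2) \<partial>M) = ennreal (expectation (\<lambda>\<omega>. (\<Sum>i\<in>I. X i \<omega>)\<^sup>2))"
  proof (rule nn_integral_eq_integral)
    show "integrable M (\<lambda>\<omega>. (\<Sum>i\<in>I. X i \<omega>)\<^sup>2)"
      by (simp add: eq prod_int)
  qed simp
  also have "expectation (\<lambda>\<omega>. (\<Sum>i\<in>I. X i \<omega>)\<^sup>2)
      = (\<Sum>i\<in>I. \<Sum>k\<in>I. expectation (\<lambda>\<omega>. X i \<omega> * X k \<omega>))"
    by (simp add: eq prod_int)
  also have "\<dots> = (\<Sum>i\<in>I. \<Sum>k\<in>I. if k = i then expectation (\<lambda>\<omega>. X i \<omega> * X i \<omega>) else 0)"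
    using cross by (intro sum.cong refl) auto
  also have "\<dots> = (\<Sum>i\<in>I. expectation (\<lambda>\<omega>. X i \<omega> * X i \<omega>))"
    using \<open>finite I\<close> by simp
  also have "\<dots> \<le> real (card I) * C"
    using sum_mono[of I "\<lambda>i. expectation (\<lambda>\<omega>. X i \<omega> * X i \<omega>)" "\<lambda>_. C"] sq_le by simp
  finally show ?thesis
    by (simp add: ennreal_leI)
qed

section \<open>Adjoints, compact operators and the Moore-Penrose inverse\<close>

lemma adj_Rvec_eq_synthesis:
  assumes "\<And>j x. j \<in> {1..m} \<Longrightarrow> L x j = inner (z j) x"
  shows "adj_Rvec m L v = synthesis {1..m} z v"
  unfolding adj_Rvec_def
proof (rule the_equality)
  show *: "\<forall>x. inner (synthesis {1..m} z v) x = (\<Sum>j=1..m. v j * L x j)"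
    using assms by (simp add: synthesis_def inner_sum_left)
  show "u = synthesis {1..m} z v" if "\<forall>x. inner u x = (\<Sum>j=1..m. v j * L x j)" for u
    by (rule vector_eq_rdot[THEN iffD1]) (use * that in simp)
qed

lemma synthesis_cong: "(\<And>j. j \<in> J \<Longrightarrow> v j = w j) \<Longrightarrow> synthesis J z v = synthesis J z w"
  by (simp add: synthesis_def)

lemma compact_operator_bounded_linear:
  assumes "compact_operator K"
  shows "bounded_linear K"
proof -
  have K: "linear K"
    using assms by (simp add: compact_operator_def)
  have "bounded (closure (K ` cball 0 1))"
    using assms bounded_cball compact_imp_bounded unfolding compact_operator_def by blast
  then have "bounded (K ` cball 0 1)"
    using bounded_subset closure_subset by blast
  then obtain b where "\<forall>y\<in>K ` cball 0 1. norm y \<le> b"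
    unfolding bounded_iff by blast
  then have b: "norm (K x) \<le> b" if "norm x \<le> 1" for x
    using that by simp
  have "norm (K x) \<le> norm x * b" for x
  proof (cases "x = 0")
    case True
    then show ?thesis
      by (simp add: linear_0[OF K])
  next
    case False
    then have "norm (K (x /\<^sub>R norm x)) \<le> b"
      by (intro b) simp
    then show ?thesis
      using False by (simp add: linear_scale[OF K] field_simps)
  qed
  then show ?thesis
    using K by (intro bounded_linear_intro[of K b]) (simp_all add: linear_add linear_scale)
qed

text \<open>Injectivity makes the condition on the kernel void, and \<open>K x - K y\<close> is both
  in the range and orthogonal to it.\<close>

lemma mp_inverse_injective:
  assumes "inj K"
    and "linear K"
  shows "mp_inverse K (K x) = x"
proof -
  have "{z. K z = 0} = {0}"
    using assms by (auto simp: linear_0 linear_injective_0)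
  moreover have "y = x" if "K x - K y \<in> (range K)\<^sup>\<bottom>" for y
  proof -
    have "K x - K y = K (x - y)"
      using assms(2) by (simp add: linear_diff)
    then have "orthogonal (K x - K y) (K x - K y)"
      using that by (auto simp: orthogonal_comp_def)
    then show ?thesis
      using assms(1) by (simp add: orthogonal_self inj_eq)
  qed
  ultimately show ?thesis
    by (auto simp: mp_inverse_def subspace_0[OF subspace_orthogonal_comp] intro!: the_equality)
qed

section \<open>The joint limit and the estimated noise level\<close>

lemma joint_limit_fst: "filterlim fst sequentially joint_limit"
  unfolding joint_limit_def by (rule filterlim_mono[OF filterlim_fst order_refl inf_le1])

lemma joint_limit_snd: "filterlim snd sequentially joint_limit"
  unfolding joint_limit_def by (rule filterlim_mono[OF filterlim_snd order_refl inf_le1])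

lemma joint_limit_sqrt_quotient:
  "filterlim (\<lambda>p. sqrt (real (fst p) / real (snd p))) (at_right 0) joint_limit"
  unfolding filterlim_at
proof
  have "((\<lambda>p. real (fst p) / real (snd p)) \<longlongrightarrow> 0) joint_limit"
    unfolding joint_limit_def case_prod_beta
    by (rule filterlim_mono[OF filterlim_filtercomap order_refl inf_le2])
  then have "((\<lambda>p. sqrt (real (fst p) / real (snd p))) \<longlongrightarrow> sqrt 0) joint_limit"
    by (rule tendsto_real_sqrt)
  then show "((\<lambda>p. sqrt (real (fst p) / real (snd p))) \<longlongrightarrow> 0) joint_limit"
    by simp
  \<comment> \<open>Approach from the right needs strict positivity, so \<open>m = 0\<close> and
    also \<open>n = 0\<close>, where division yields 0, must be excluded.\<close>
  show "\<forall>\<^sub>F p in joint_limit. sqrt (real (fst p) / real (snd p)) \<in> {0<..} \<and>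
      sqrt (real (fst p) / real (snd p)) \<noteq> 0"
    using eventually_compose_filterlim[OF eventually_ge_at_top[of 1] joint_limit_fst]
      eventually_compose_filterlim[OF eventually_ge_at_top[of 1] joint_limit_snd]
    by eventually_elim simp
qed

section \<open>Convergence in mean square\<close>

theorem theorem2p8:
  fixes K :: "'a::{real_inner, complete_space} \<Rightarrow> 'b::{real_inner, complete_space}"
    and xhat :: 'a and yhat :: 'b
    and l :: "nat \<Rightarrow> nat \<Rightarrow> 'b \<Rightarrow> real"
    and A :: "'b \<Rightarrow> 'b"
    and M :: "'w measure"
    and \<delta> :: "nat \<Rightarrow> nat \<Rightarrow> nat \<Rightarrow> 'w \<Rightarrow> real"
    and C\<^sub>d \<kappa> :: real
    and F :: "real \<Rightarrow> real \<Rightarrow> real" and \<nu>0 :: ereal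
    and \<alpha> :: "real \<Rightarrow> real"
  assumes K_compact: "compact_operator K"
    and K_inj: "inj K"
    and yhat_dom: "yhat \<in> mp_domain K"
    and yhat_exact: "K xhat = yhat"
    and l_bounded_linear: "\<And>m j. 1 \<le> j \<Longrightarrow> j \<le> m \<Longrightarrow> bounded_linear (l m j)"
    and l_norms: "\<And>m j k. 1 \<le> j \<Longrightarrow> j \<le> m \<Longrightarrow> 1 \<le> k \<Longrightarrow> k \<le> m \<Longrightarrow> onorm (l m j) = onorm (l m k)"
    and PP_bij: "\<And>m. 1 \<le> m \<Longrightarrow>
          bij_betw (\<lambda>v. discr l m (adj_Rvec m (discr l m) v)) (Rvec m) (Rvec m)"
    and A_bounded_linear: "bounded_linear A"
    and A_inj: "inj A"
    and A_limit: "\<And>y. (\<lambda>m. adj_Rvec m (discr l m) (discr l m y)) \<longlonglongrightarrow> A y"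
    and prob: "prob_space M"
    and \<delta>_indep: "\<And>m j. 1 \<le> j \<Longrightarrow> j \<le> m \<Longrightarrow>
          prob_space.indep_vars M (\<lambda>_. borel) (\<lambda>i. \<delta> m i j) {1..}"
    and \<delta>_mean: "\<And>m i j. 1 \<le> i \<Longrightarrow> 1 \<le> j \<Longrightarrow> j \<le> m \<Longrightarrow>
          integrable M (\<delta> m i j) \<and> prob_space.expectation M (\<delta> m i j) = 0"
    and \<delta>_var: "\<And>m i j. 1 \<le> i \<Longrightarrow> 1 \<le> j \<Longrightarrow> j \<le> m \<Longrightarrow>
          (\<integral>\<^sup>+\<omega>. ennreal ((\<delta> m i j \<omega>)\<^sup>2) \<partial>M) \<le> ennreal C\<^sub>d"
    \<comment> \<open>\<open>[0, \<kappa>]\<close> is the common domain of the filter functions. The usual choice is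
      \<open>\<kappa> = \<parallel>K\<parallel>\<^sup>2\<close>. It has to contain the spectra of the \<open>(P\<^sub>m K)\<^sup>* P\<^sub>m K\<close> for
      \<open>F\<^sub>\<alpha>((P\<^sub>m K)\<^sup>* P\<^sub>m K)\<close> to be defined.\<close>
    and \<kappa>_ge: "(onorm K)\<^sup>2 \<le> \<kappa>"
    and spectra: "\<And>m. 1 \<le> m \<Longrightarrow> eigenvalues (gram l K m) \<subseteq> {0..\<kappa>}"
    and filter: "regularising_filter \<kappa> F \<nu>0"
    and \<alpha>_pos: "\<And>d. 0 < d \<Longrightarrow> 0 < \<alpha> d"
    and \<alpha>_lim: "(\<alpha> \<longlongrightarrow> 0) (at_right 0)"
    and \<alpha>_rate: "((\<lambda>d. d / sqrt (\<alpha> d)) \<longlongrightarrow> 0) (at_right 0)"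
  shows "((\<lambda>(m, n). \<integral>\<^sup>+\<omega>. ennreal ((norm
            (regularisation F l K m (\<alpha> (sqrt (real m / real n))) (mean_measurement l yhat \<delta> m n \<omega>)
             - mp_inverse K yhat))\<^sup>2) \<partial>M) \<longlongrightarrow> 0) joint_limit"
proof -

  \<comment> \<open>Reduction to frame operators and their strong limit\<close>
  interpret prob_space M by fact
  have K: "bounded_linear K"
    by (rule compact_operator_bounded_linear[OF K_compact])
  interpret K: bounded_linear K by fact
  interpret A: bounded_linear A by fact
  obtain K' where K': "bounded_linear K'" "\<And>y x. inner (K' y) x = inner y (K x)"
    using hilbert_adjoint_exists[OF K] by blast
  interpret K': bounded_linear K' by fact
  define w where "w m j = (SOME u. \<forall>y. l m j y = inner u y)" for m j
  have w: "l m j y = inner (w m j) y" if "1 \<le> j \<and> j \<le> m" for m j y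
  proof -
    have "\<exists>u. \<forall>y. l m j y = inner u y"
      using riesz_representation[OF l_bounded_linear[of j m]] that by metis
    then show ?thesis
      unfolding w_def by (rule someI_ex[THEN spec])
  qed
  \<comment> \<open>These represent the functionals \<open>l m j\<close> composed with
    \<open>K\<close>, so that \<open>gram l K m\<close> becomes the frame operator
    \<open>T m\<close>.\<close>
  define z where "z m j = K' (w m j)" for m j
  define T where "T m = frame_operator {1..m} (z m)" for m
  define G where "G x = K' (A (K x))" for x
  have l_K: "(discr l m \<circ> K) x j = inner (z m j) x" if "j \<in> {1..m}" for m j x
    using that by (simp add: discr_def z_def K'(2) w)
  have adj: "adj_Rvec m (discr l m) (discr l m y) = frame_operator {1..m} (w m) y" for m y
  proof -
    have "adj_Rvec m (discr l m) (discr l m y) = synthesis {1..m} (w m) (discr l m y)"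
      by (rule adj_Rvec_eq_synthesis) (simp add: discr_def w)
    also have "\<dots> = frame_operator {1..m} (w m) y"
      unfolding frame_operator_def by (rule synthesis_cong) (simp add: discr_def w)
    finally show ?thesis .
  qed
  have A: "(\<lambda>m. frame_operator {1..m} (w m) y) \<longlonglongrightarrow> A y" for y
    using A_limit[of y] by (simp only: adj)
  note A_sa = frame_operator_limit_self_adjoint[OF A]
  note A_CS = frame_operator_limit_Cauchy_Schwarz[OF A]
  have gram: "gram l K m = T m" for m
  proof
    fix x
    have "gram l K m x = synthesis {1..m} (z m) (discr l m (K x))"
      unfolding gram_def by (rule adj_Rvec_eq_synthesis[OF l_K])
    also have "\<dots> = T m x"
      unfolding T_def frame_operator_def by (rule synthesis_cong) (use l_K in simp)
    finally show "gram l K m x = T m x" .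
  qed
  have spec: "eigenvalues (T m) \<subseteq> {0..\<kappa>}" if "1 \<le> m" for m
    using spectra[OF that] by (simp add: gram)
  have T_eq: "T m x = K' (frame_operator {1..m} (w m) (K x))" for m x
    by (simp add: T_def frame_operator_def synthesis_def z_def K'.sum K'.scaleR K'(2))
  have T_lim: "(\<lambda>m. T m x) \<longlonglongrightarrow> G x" for x
    unfolding T_eq G_def by (rule K'.tendsto[OF A])
  \<comment> \<open>Here positivity of \<open>A\<close> enters: \<open>inner (G x) x\<close> is the
    form of \<open>A\<close> at \<open>K x\<close>, and \<open>A_CS\<close> turns its vanishing into
    \<open>A (K x) = 0\<close>.\<close>
  have "G x = 0 \<Longrightarrow> x = 0" for x
  proof -
    assume "G x = 0"
    then have "inner (A (K x)) (K x) = 0"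
      using K'(2)[of "A (K x)" x] by (simp add: G_def)
    then have "(inner (A (K x)) (A (K x)))\<^sup>2 \<le> 0"
      using A_CS[of "K x" "A (K x)"] by simp
    then have "A (K x) = A 0"
      by (simp add: A.zero)
    then have "K x = 0"
      by (rule injD[OF A_inj])
    then have "K x = K 0"
      by (simp only: K.zero)
    then show "x = 0"
      by (rule injD[OF K_inj])
  qed
  moreover have "inner (G x) y = inner x (G y)" for x y
  proof -
    have "inner (G x) y = inner (A (K x)) (K y)" "inner (G y) x = inner (A (K y)) (K x)"
      by (simp_all add: G_def K'(2))
    then show ?thesis
      by (simp only: A_sa[of "K x"] inner_commute[of x] inner_commute[of "K x"])
  qed
  moreover have "linear G"
    unfolding G_def
    by (intro bounded_linear.linear bounded_linear_compose[OF K'(1)]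
        bounded_linear_compose[OF A_bounded_linear] K)
  ultimately have dense: "closure (range G) = UNIV"
    by (intro dense_range_if_injective_self_adjoint)

  \<comment> \<open>Parameter choice, bias and the majorant\<close>
  define d where "d p = sqrt (real (fst p) / real (snd p))" for p :: "nat \<times> nat"
  have d: "filterlim d (at_right 0) joint_limit"
    unfolding d_def by (rule joint_limit_sqrt_quotient)
  have "\<forall>\<^sub>F d in at_right (0::real). 0 < d"
    by (rule eventually_at_right_less)
  then have "\<forall>\<^sub>F d in at_right 0. \<alpha> d \<in> {0<..} \<and> \<alpha> d \<noteq> 0"
    by eventually_elim (use \<alpha>_pos in force)
  then have "filterlim \<alpha> (at_right 0) (at_right 0)"
    using \<alpha>_lim by (simp add: filterlim_at)
  then have a: "filterlim (\<lambda>p. \<alpha> (d p)) (at_right 0) joint_limit"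
    using d by (rule filterlim_compose)
  define bias where "bias p = fun_calculus (F (\<alpha> (d p))) (T (fst p)) (T (fst p) xhat) - xhat" for p
  have bias: "(bias \<longlongrightarrow> 0) joint_limit"
    unfolding bias_def T_def
    by (rule residual_tendsto_0[OF _ _ _ dense filter a joint_limit_fst])
      (use spec T_lim in \<open>simp_all add: T_def\<close>)
  obtain C where C: "0 \<le> C" "\<And>\<alpha> t. 0 < \<alpha> \<Longrightarrow> t \<in> {0<..\<kappa>} \<Longrightarrow> t * (F \<alpha> t)\<^sup>2 \<le> C / \<alpha>"
    using regularising_filter_square_bound[OF filter] by blast
  \<comment> \<open>The factors 2 come from splitting the square of bias plus noise; the last square
    is \<open>m / n\<close> divided by the regularisation parameter.\<close>
  define ub where "ub p = 2 * (norm (bias p))\<^sup>2 + 2 * (C * \<bar>C\<^sub>d\<bar>) * (d p / sqrt (\<alpha> (d p)))\<^sup>2" for p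
  have "((\<lambda>p. d p / sqrt (\<alpha> (d p))) \<longlongrightarrow> 0) joint_limit"
    using \<alpha>_rate d by (rule filterlim_compose)
  then have "(ub \<longlongrightarrow> 2 * (norm (0::'a))\<^sup>2 + 2 * (C * \<bar>C\<^sub>d\<bar>) * 0\<^sup>2) joint_limit"
    unfolding ub_def by (intro tendsto_intros bias)
  then have ub_lim: "((\<lambda>p. ennreal (ub p)) \<longlongrightarrow> 0) joint_limit"
    using tendsto_ennrealI by fastforce
  have bound: "(\<integral>\<^sup>+\<omega>. ennreal ((norm
            (regularisation F l K m (\<alpha> (d (m, n))) (mean_measurement l yhat \<delta> m n \<omega>)
             - mp_inverse K yhat))\<^sup>2) \<partial>M) \<le> ennreal (ub (m, n))"
    if mn: "1 \<le> m" "1 \<le> n" for m n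
  proof -
    define s where "s j \<omega> = (\<Sum>i\<in>{1..n}. \<delta> m i j \<omega>)" for j \<omega>
    define \<alpha>' where "\<alpha>' = \<alpha> (d (m, n))"
    have d_pos: "0 < d (m, n)" and d_sq: "(d (m, n))\<^sup>2 = real m / real n"
      using mn by (simp_all add: d_def)
    have \<alpha>': "0 < \<alpha>'"
      unfolding \<alpha>'_def by (rule \<alpha>_pos[OF d_pos])
    define noise where "noise \<omega> = fun_calculus (F \<alpha>') (T m) (synthesis {1..m} (z m) (\<lambda>j. s j \<omega> / n))" for \<omega>
    have err: "regularisation F l K m \<alpha>' (mean_measurement l yhat \<delta> m n \<omega>) - mp_inverse K yhat
        = bias (m, n) + noise \<omega>" for \<omega>
    proof -
      have mean: "mean_measurement l yhat \<delta> m n \<omega> j = inner (z m j) xhat + s j \<omega> / n"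
        if "j \<in> {1..m}" for j
      proof -
        have "l m j yhat = inner (z m j) xhat"
          using l_K[OF that, of xhat] that by (simp add: discr_def yhat_exact)
        then show ?thesis
          using that mn
          by (simp add: mean_measurement_def measurement_def s_def sum.distrib field_simps)
      qed
      have "regularisation F l K m \<alpha>' (mean_measurement l yhat \<delta> m n \<omega>)
          = fun_calculus (F \<alpha>') (T m) (synthesis {1..m} (z m) (mean_measurement l yhat \<delta> m n \<omega>))"
        unfolding regularisation_def gram by (subst adj_Rvec_eq_synthesis[OF l_K]) simp_all
      also have "synthesis {1..m} (z m) (mean_measurement l yhat \<delta> m n \<omega>)
          = synthesis {1..m} (z m) (\<lambda>j. inner (z m j) xhat) + synthesis {1..m} (z m) (\<lambda>j. s j \<omega> / n)"
        unfolding synthesis_add[symmetric] by (rule synthesis_cong[OF mean])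
      also have "fun_calculus (F \<alpha>') (T m) \<dots>
          = fun_calculus (F \<alpha>') (T m) (T m xhat) + noise \<omega>"
        unfolding T_def noise_def by (subst fun_calculus_synthesis_add) (simp_all add: frame_operator_def)
      finally show ?thesis
        using mp_inverse_injective[OF K_inj K.linear, of xhat]
        by (simp add: bias_def \<alpha>'_def yhat_exact)
    qed
    have noise: "(norm (noise \<omega>))\<^sup>2 \<le> C / \<alpha>' / n\<^sup>2 * (\<Sum>j=1..m. (s j \<omega>)\<^sup>2)" for \<omega>
    proof -
      have "(norm (noise \<omega>))\<^sup>2 \<le> \<bar>C / \<alpha>'\<bar> * (\<Sum>j=1..m. (s j \<omega> / n)\<^sup>2)"
        unfolding noise_def T_def
        by (rule norm_fun_calculus_synthesis_le[OF _ _ C(2)[OF \<alpha>']]) (use spec[OF mn(1)] in \<open>simp_all add: T_def\<close>)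
      also have "\<dots> = C / \<alpha>' / n\<^sup>2 * (\<Sum>j=1..m. (s j \<omega>)\<^sup>2)"
        using C(1) \<alpha>' by (simp add: power_divide flip: sum_divide_distrib)
      finally show ?thesis .
    qed
    have s_meas: "s j \<in> borel_measurable M" if "j \<in> {1..m}" for j
      unfolding s_def using \<delta>_mean that by (intro borel_measurable_sum) auto
    \<comment> \<open>Independence is used across repetitions \<open>i\<close> for fixed
      \<open>j\<close>; summing squares over \<open>j\<close> produces no products of different
      components.\<close>
    have s_var: "(\<integral>\<^sup>+\<omega>. ennreal ((s j \<omega>)\<^sup>2) \<partial>M) \<le> ennreal (n * \<bar>C\<^sub>d\<bar>)" if j: "j \<in> {1..m}" for j
    proof -
      have "(\<integral>\<^sup>+\<omega>. ennreal ((s j \<omega>)\<^sup>2) \<partial>M) \<le> ennreal (real (card {1..n}) * \<bar>C\<^sub>d\<bar>)"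
        unfolding s_def
      proof (rule nn_integral_square_sum_indep_le)
        show "indep_vars (\<lambda>_. borel) (\<lambda>i. \<delta> m i j) {1..n}"
          by (rule indep_vars_subset[OF \<delta>_indep]) (use j in auto)
        show "(\<integral>\<^sup>+\<omega>. ennreal ((\<delta> m i j \<omega>)\<^sup>2) \<partial>M) \<le> ennreal \<bar>C\<^sub>d\<bar>" if "i \<in> {1..n}" for i
          using \<delta>_var[of i j m] that j by (force intro: order_trans ennreal_leI)
      qed (use \<delta>_mean j in auto)
      then show ?thesis
        by simp
    qed
    have sq_add: "(norm (x + y))\<^sup>2 \<le> 2 * (norm x)\<^sup>2 + 2 * (norm y)\<^sup>2" for x y :: 'a
    proof -
      have "(norm (x + y))\<^sup>2 + (norm (x - y))\<^sup>2 = 2 * (norm x)\<^sup>2 + 2 * (norm y)\<^sup>2"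
        by (simp add: power2_norm_eq_inner inner_simps inner_commute)
      then show ?thesis
        by (smt (verit) zero_le_power2)
    qed
    define c where "c = 2 * (C / \<alpha>' / n\<^sup>2)"
    have "0 \<le> c"
      using C(1) \<alpha>' by (simp add: c_def)
    \<comment> \<open>Monotonicity of the integral applies to the pointwise bound directly, so
      measurability is checked only for the sums \<open>s j\<close>.\<close>
    have "(\<integral>\<^sup>+\<omega>. ennreal ((norm (bias (m, n) + noise \<omega>))\<^sup>2) \<partial>M)
        \<le> (\<integral>\<^sup>+\<omega>. ennreal (2 * (norm (bias (m, n)))\<^sup>2) + ennreal c * (\<Sum>j=1..m. ennreal ((s j \<omega>)\<^sup>2)) \<partial>M)"
    proof (rule nn_integral_mono)
      fix \<omega>
      have "(norm (bias (m, n) + noise \<omega>))\<^sup>2 \<le> 2 * (norm (bias (m, n)))\<^sup>2 + c * (\<Sum>j=1..m. (s j \<omega>)\<^sup>2)"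
        using sq_add[of "bias (m, n)" "noise \<omega>"] noise[of \<omega>] unfolding c_def by linarith
      then have "ennreal ((norm (bias (m, n) + noise \<omega>))\<^sup>2)
          \<le> ennreal (2 * (norm (bias (m, n)))\<^sup>2 + c * (\<Sum>j=1..m. (s j \<omega>)\<^sup>2))"
        by (rule ennreal_leI)
      also have "\<dots> = ennreal (2 * (norm (bias (m, n)))\<^sup>2) + ennreal c * (\<Sum>j=1..m. ennreal ((s j \<omega>)\<^sup>2))"
        using \<open>0 \<le> c\<close> by (simp add: ennreal_plus ennreal_mult sum_nonneg sum_ennreal)
      finally show "ennreal ((norm (bias (m, n) + noise \<omega>))\<^sup>2)
          \<le> ennreal (2 * (norm (bias (m, n)))\<^sup>2) + ennreal c * (\<Sum>j=1..m. ennreal ((s j \<omega>)\<^sup>2))" .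
    qed
    also have "\<dots> = ennreal (2 * (norm (bias (m, n)))\<^sup>2)
        + ennreal c * (\<Sum>j=1..m. \<integral>\<^sup>+\<omega>. ennreal ((s j \<omega>)\<^sup>2) \<partial>M)"
    proof -
      have meas: "(\<lambda>\<omega>. ennreal ((s j \<omega>)\<^sup>2)) \<in> borel_measurable M" if "j \<in> {1..m}" for j
        using s_meas[OF that] by measurable
      then have "(\<lambda>\<omega>. \<Sum>j=1..m. ennreal ((s j \<omega>)\<^sup>2)) \<in> borel_measurable M"
        by (rule borel_measurable_sum)
      moreover have "(\<integral>\<^sup>+\<omega>. (\<Sum>j=1..m. ennreal ((s j \<omega>)\<^sup>2)) \<partial>M) = (\<Sum>j=1..m. \<integral>\<^sup>+\<omega>. ennreal ((s j \<omega>)\<^sup>2) \<partial>M)"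
        by (rule nn_integral_sum[OF meas])
      ultimately show ?thesis
        by (simp add: nn_integral_add nn_integral_cmult emeasure_space_1 del: sum_ennreal)
    qed
    also have "\<dots> \<le> ennreal (2 * (norm (bias (m, n)))\<^sup>2) + ennreal c * (\<Sum>j=1..m. ennreal (n * \<bar>C\<^sub>d\<bar>))"
      by (intro add_left_mono mult_left_mono sum_mono s_var) auto
    also have "\<dots> = ennreal (2 * (norm (bias (m, n)))\<^sup>2 + c * (m * (n * \<bar>C\<^sub>d\<bar>)))"
    proof -
      have "(\<Sum>j=1..m. ennreal (n * \<bar>C\<^sub>d\<bar>)) = ennreal (m * (n * \<bar>C\<^sub>d\<bar>))"
        by (subst sum_ennreal) simp_all
      then show ?thesis
        using \<open>0 \<le> c\<close> ennreal_mult[of c "m * (n * \<bar>C\<^sub>d\<bar>)"] by (simp only:) simp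
    qed
    \<comment> \<open>Averaging contributes \<open>1 / n\<^sup>2\<close> inside \<open>c\<close>,
      and the \<open>m\<close> components contribute \<open>n * \<bar>C\<^sub>d\<bar>\<close> each,
      which leaves the ratio \<open>m / n\<close>.\<close>
    also have "2 * (norm (bias (m, n)))\<^sup>2 + c * (m * (n * \<bar>C\<^sub>d\<bar>)) = ub (m, n)"
      using \<alpha>' mn by (simp add: ub_def c_def power_divide d_sq flip: \<alpha>'_def)
        (simp add: field_simps power2_eq_square)
    finally show ?thesis
      by (simp add: err flip: \<alpha>'_def)
  qed
  show ?thesis
  proof (rule tendsto_sandwich[OF _ _ tendsto_const ub_lim])
    have "\<forall>\<^sub>F p in joint_limit. 1 \<le> fst p" "\<forall>\<^sub>F p in joint_limit. 1 \<le> snd p"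
      by (rule eventually_compose_filterlim[OF eventually_ge_at_top joint_limit_fst])
        (rule eventually_compose_filterlim[OF eventually_ge_at_top joint_limit_snd])
    then show "\<forall>\<^sub>F p in joint_limit. (case p of (m, n) \<Rightarrow> \<integral>\<^sup>+\<omega>. ennreal ((norm
            (regularisation F l K m (\<alpha> (sqrt (real m / real n))) (mean_measurement l yhat \<delta> m n \<omega>)
             - mp_inverse K yhat))\<^sup>2) \<partial>M) \<le> ennreal (ub p)"
    proof eventually_elim
      case (elim p)
      then show ?case
        using bound[of "fst p" "snd p"] by (simp add: case_prod_beta d_def)
    qed
  qed simp
qed

end
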